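(* Let $n\ge3$ and $d\ge2$. For every $T\in\mathbb{T}_n^d$ there exists $A\in\mathbb{A}_n^d$ such that $T\circ A$ fixes every corner of the cube $n^d$ and fixes every point of the line $\ell=\{[i,0,\dots,0]: i\in[n]\}$.
   Context: Let $[n]=\{0,\dots,n-1\}$; the cube $n^d$ is $[n]^d$. A set of $n$ distinct points is a line if it can be ordered $(q^1,\dots,q^n)$ such that in each coordinate the sequence of values is strictly increasing, strictly decreasing or constant, with at least one coordinate non-constant. $\mathbb{T}_n^d$ is the group of permutations of $[n]^d$ mapping lines onto lines. Composition is written left to right: $(T\circ A)(p)=A(T(p))$. A corner is a point all of whose coordinates lie in $\{0,n-1\}$. $\mathbb{R}_d$ is the group generated by the maps $R_{ij}$ ($i\ne j$), where $R_{ij}([x_1,\dots,x_d])$ has $i$-th coordinate $n-x_j-1$, $j$-th coordinate $x_i$, and other coordinates unchanged. $\mathbb{F}_n$ is the group of maps $F_\pi([x_1,\dots,x_d])=[\pi(x_1),\dots,\pi(x_d)]$ for permutations $\pi$ of $[n]$ with $\pi(n-p-1)=n-\pi(p)-1$ for all $p$. $\mathbb{X}=\{\mathit{Id},X\}$ with $X([x_1,\dots,x_{d-1},x_d])=[x_1,\dots,x_d,x_{d-1}]$. $\mathbb{A}_n^d$ is the group generated by $\mathbb{R}_d\cup\mathbb{F}_n\cup\mathbb{X}$. *)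

theory Defs
  imports "HOL-Algebra.Bij" "HOL-Algebra.Generated_Groups" "HOL-Combinatorics.Permutations"
begin

definition cube :: "nat \<Rightarrow> nat \<Rightarrow> nat list set" where
  "cube n d = {x. length x = d \<and> set x \<subseteq> {..<n}}"

text \<open>A point $[x_1,\dots,x_d]$ is a list of length $d$, so the mathematical coordinate $x_i$ is
  the list entry at position $i - 1$. Permutations of the cube are elements of
  \<^term>\<open>Bij (cube n d)\<close>, i.e. bijections of the cube that are \<^term>\<open>undefined\<close> outside it;
  the left-to-right composite $T \circ A$ is \<^term>\<open>compose (cube n d) A T\<close>.\<close>

definition is_line :: "nat \<Rightarrow> nat \<Rightarrow> nat list set \<Rightarrow> bool" where
  "is_line n d L \<longleftrightarrow> L \<subseteq> cube n d \<and>
     (\<exists>q. bij_betw q {..<n} L \<and>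
        (\<forall>i<d. monotone_on {..<n} (<) (<) (\<lambda>k. q k ! i) \<or>
               monotone_on {..<n} (<) (>) (\<lambda>k. q k ! i) \<or>
               (\<exists>c. \<forall>k<n. q k ! i = c)) \<and>
        (\<exists>i<d. \<not> (\<exists>c. \<forall>k<n. q k ! i = c)))"

definition line_perms :: "nat \<Rightarrow> nat \<Rightarrow> (nat list \<Rightarrow> nat list) set" where
  "line_perms n d = {T \<in> Bij (cube n d). \<forall>L. is_line n d L \<longrightarrow> is_line n d (T ` L)}"

definition corners :: "nat \<Rightarrow> nat \<Rightarrow> nat list set" where
  "corners n d = {x \<in> cube n d. set x \<subseteq> {0, n - 1}}"

definition rot :: "nat \<Rightarrow> nat \<Rightarrow> nat \<Rightarrow> nat \<Rightarrow> nat list \<Rightarrow> nat list" where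
  "rot n d i j = (\<lambda>x \<in> cube n d. x[i := n - x ! j - 1, j := x ! i])"

definition rot_group :: "nat \<Rightarrow> nat \<Rightarrow> (nat list \<Rightarrow> nat list) set" where
  "rot_group n d = generate (BijGroup (cube n d)) {rot n d i j | i j. i < d \<and> j < d \<and> i \<noteq> j}"

definition coord_map :: "nat \<Rightarrow> nat \<Rightarrow> (nat \<Rightarrow> nat) \<Rightarrow> nat list \<Rightarrow> nat list" where
  "coord_map n d \<pi> = (\<lambda>x \<in> cube n d. map \<pi> x)"

definition coord_group :: "nat \<Rightarrow> nat \<Rightarrow> (nat list \<Rightarrow> nat list) set" where
  "coord_group n d = {coord_map n d \<pi> | \<pi>. \<pi> permutes {..<n} \<and>
     (\<forall>p<n. \<pi> (n - p - 1) = n - \<pi> p - 1)}"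

definition swap_last :: "nat \<Rightarrow> nat \<Rightarrow> nat list \<Rightarrow> nat list" where
  "swap_last n d = (\<lambda>x \<in> cube n d. x[d - 2 := x ! (d - 1), d - 1 := x ! (d - 2)])"

definition swap_group :: "nat \<Rightarrow> nat \<Rightarrow> (nat list \<Rightarrow> nat list) set" where
  "swap_group n d = {\<one>\<^bsub>BijGroup (cube n d)\<^esub>, swap_last n d}"

definition aut_group :: "nat \<Rightarrow> nat \<Rightarrow> (nat list \<Rightarrow> nat list) set" where
  "aut_group n d =
     generate (BijGroup (cube n d)) (rot_group n d \<union> coord_group n d \<union> swap_group n d)"

definition first_axis :: "nat \<Rightarrow> nat \<Rightarrow> nat list set" where
  "first_axis n d = {i # replicate (d - 1) 0 | i. i < n}"

text \<open>The operation \<^const>\<open>generate\<close> is only meaningful for subsets of the carrier; the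
  following facts show that all the generators are permutations of the cube.\<close>

lemma finite_cube: "finite (cube n d)"
proof -
  have "cube n d = {xs. set xs \<subseteq> {..<n} \<and> length xs = d}" by (auto simp: cube_def)
  then show ?thesis by (simp add: finite_lists_length_eq)
qed

lemma BijI_cube:
  assumes "f \<in> extensional (cube n d)" "f ` cube n d \<subseteq> cube n d" "inj_on f (cube n d)"
  shows "f \<in> Bij (cube n d)"
  using assms endo_inj_surj[OF finite_cube] by (auto simp: Bij_def bij_betw_def)

lemma cube_iff: "x \<in> cube n d \<longleftrightarrow> length x = d \<and> (\<forall>k<d. x ! k < n)"
  by (auto simp: cube_def set_conv_nth)

lemma rot_Bij:
  assumes "i < d" "j < d" "i \<noteq> j"
  shows "rot n d i j \<in> Bij (cube n d)"
proof (rule BijI_cube)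
  show "rot n d i j \<in> extensional (cube n d)" by (simp add: rot_def)
  show "rot n d i j ` cube n d \<subseteq> cube n d"
  proof
    fix y assume "y \<in> rot n d i j ` cube n d"
    then obtain x where x: "x \<in> cube n d" "y = x[i := n - x ! j - 1, j := x ! i]"
      by (auto simp: rot_def)
    have "x ! j < n" using x assms by (auto simp: cube_iff)
    then show "y \<in> cube n d" using x assms by (auto simp: cube_iff nth_list_update)
  qed
  show "inj_on (rot n d i j) (cube n d)"
  proof (rule inj_onI)
    fix x y assume x: "x \<in> cube n d" and y: "y \<in> cube n d"
      and "rot n d i j x = rot n d i j y"
    then have eq: "x[i := n - x ! j - 1, j := x ! i] = y[i := n - y ! j - 1, j := y ! i]"
      by (simp add: rot_def)
    have len: "length x = d" "length y = d" using x y by (auto simp: cube_iff)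
    have b: "x ! j < n" "y ! j < n" using x y assms by (auto simp: cube_iff)
    show "x = y"
    proof (rule nth_equalityI)
      show "length x = length y" using len by simp
      fix k assume k: "k < length x"
      have i: "x ! i = y ! i" using arg_cong[OF eq, of "\<lambda>z. z ! j"] assms len by simp
      have "n - x ! j - 1 = n - y ! j - 1"
        using arg_cong[OF eq, of "\<lambda>z. z ! i"] assms len by simp
      then have j: "x ! j = y ! j" using b by linarith
      show "x ! k = y ! k"
        using arg_cong[OF eq, of "\<lambda>z. z ! k"] i j k len
        by (cases "k = i"; cases "k = j") auto
    qed
  qed
qed

lemma coord_group_Bij: "coord_group n d \<subseteq> Bij (cube n d)"
proof
  fix f assume "f \<in> coord_group n d"
  then obtain \<pi> where f: "f = coord_map n d \<pi>" and p: "\<pi> permutes {..<n}"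
    by (auto simp: coord_group_def)
  show "f \<in> Bij (cube n d)"
  proof (rule BijI_cube)
    show "f \<in> extensional (cube n d)" by (simp add: f coord_map_def)
    have "\<pi> k < n" if "k < n" for k using permutes_in_image[OF p, of k] that by simp
    then show "f ` cube n d \<subseteq> cube n d"
      by (auto simp: f coord_map_def cube_iff)
    have "inj_on (map \<pi>) (cube n d)"
      using permutes_inj[OF p] by (rule inj_on_subset[OF inj_mapI]) simp
    then show "inj_on f (cube n d)" by (simp add: f coord_map_def)
  qed
qed

lemma swap_last_Bij:
  assumes "d \<ge> 2"
  shows "swap_last n d \<in> Bij (cube n d)"
proof (rule BijI_cube)
  show "swap_last n d \<in> extensional (cube n d)" by (simp add: swap_last_def)
  have len: "length (swap_last n d x) = d" if "x \<in> cube n d" for x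
    using that by (simp add: swap_last_def cube_iff)
  have nth: "swap_last n d x ! k =
      (if k = d - 1 then x ! (d - 2) else if k = d - 2 then x ! (d - 1) else x ! k)"
    if "x \<in> cube n d" "k < d" for x k
    using that by (simp add: swap_last_def cube_iff nth_list_update)
  have mem: "swap_last n d x \<in> cube n d" if x: "x \<in> cube n d" for x
  proof -
    have "swap_last n d x ! k < n" if "k < d" for k
      using x that assms unfolding nth[OF x that] by (simp add: cube_iff)
    then show ?thesis using len[OF x] by (simp add: cube_iff)
  qed
  show "swap_last n d ` cube n d \<subseteq> cube n d" using mem by blast
  have inv: "swap_last n d (swap_last n d x) = x" if x: "x \<in> cube n d" for x
  proof (rule nth_equalityI)
    show "length (swap_last n d (swap_last n d x)) = length x"
      using len[OF mem[OF x]] x by (simp add: cube_iff)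
    fix k assume "k < length (swap_last n d (swap_last n d x))"
    then have k: "k < d" by (simp add: len[OF mem[OF x]])
    have "d - 1 < d" "d - 2 < d" "d - 2 \<noteq> d - 1" using assms by auto
    then show "swap_last n d (swap_last n d x) ! k = x ! k"
      by (simp only: nth[OF mem[OF x] k] nth[OF x] k) auto
  qed
  show "inj_on (swap_last n d) (cube n d)" by (rule inj_on_inverseI) (rule inv)
qed

lemma rot_group_Bij: "rot_group n d \<subseteq> Bij (cube n d)"
proof -
  have "{rot n d i j | i j. i < d \<and> j < d \<and> i \<noteq> j} \<subseteq> carrier (BijGroup (cube n d))"
    using rot_Bij by (auto simp: BijGroup_def)
  from group.generate_incl[OF group_BijGroup this]
  show ?thesis by (simp add: rot_group_def BijGroup_def)
qed

lemma swap_group_Bij: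
  assumes "d \<ge> 2"
  shows "swap_group n d \<subseteq> Bij (cube n d)"
  using swap_last_Bij[OF assms] monoid.one_closed[OF group.is_monoid[OF group_BijGroup]]
  by (auto simp: swap_group_def BijGroup_def)

lemma subgroup_aut_group:
  assumes "d \<ge> 2"
  shows "subgroup (aut_group n d) (BijGroup (cube n d))"
  unfolding aut_group_def
  using rot_group_Bij coord_group_Bij swap_group_Bij[OF assms]
  by (intro group.generate_is_subgroup group_BijGroup) (simp add: BijGroup_def)

end

theory Submission
  imports Defs
begin

text \<open>
  Write \<open>opp k = n - 1 - k\<close> and call a point diagonal if all its coordinates lie in one set
  \<open>{k, opp k}\<close>; these are the points on lines along which every coordinate varies. A line
  permutation preserves diagonal points. For even \<open>n\<close> they are the points on the maximal number
  of lines. For odd \<open>n\<close> that maximum singles out the centre; among the lines through the centre,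
  those with two non-central points collinear with a given \<open>p\<close> vary exactly in the non-central
  coordinates of \<open>p\<close>, and counting them shows that diagonal points keep having no central
  coordinate.

  Two corners sharing a coordinate span a line that is not full, so their images have the same
  level \<open>{k, opp k}\<close>; hence all corners are sent to one level, which a coordinate map moves back to
  the corners. Adjacency of corners is an incidence property: exactly for edges no other line
  through two corners comes close to the inner points of the spanned line. The generators yield all
  signed permutations of the coordinates; one of them makes the permutation fix the origin and its
  neighbours, hence all corners. It now preserves the first two axes and both diagonals of the plane
  they span, which forces the induced permutation of the first axis to commute with \<open>opp\<close>, so that
  it can be undone by a coordinate map.
\<close>

lemma strict_mono_on_lessThan_eq_id:
  fixes f :: "nat \<Rightarrow> nat"
  assumes mono: "monotone_on {..<n} (<) (<) f" and less: "\<And>k. k < n \<Longrightarrow> f k < n" and "k < n"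
  shows "f k = k"
proof -
  have growth: "f k + m \<le> f (k + m)" if "k + m < n" for k m
    using that
  proof (induction m)
    case (Suc m)
    have "f (k + m) < f (k + Suc m)"
      using Suc.prems by (intro monotone_onD[OF mono]) auto
    with Suc show ?case by simp
  qed simp
  have "f k + (n - 1 - k) \<le> f (n - 1)" using growth[of k "n - 1 - k"] \<open>k < n\<close> by simp
  moreover have "f (n - 1) < n" using less \<open>k < n\<close> by simp
  ultimately have "f k \<le> k" using \<open>k < n\<close> by linarith
  moreover have "k \<le> f k" using growth[of 0 k] \<open>k < n\<close> by simp
  ultimately show ?thesis by simp
qed

lemma strict_antimono_on_lessThan_eq:
  fixes f :: "nat \<Rightarrow> nat"
  assumes anti: "monotone_on {..<n} (<) (>) f" and less: "\<And>k. k < n \<Longrightarrow> f k < n" and "k < n"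
  shows "f k = n - 1 - k"
proof -
  have "monotone_on {..<n} (<) (<) (\<lambda>k. n - 1 - f k)"
  proof (rule monotone_onI)
    fix i j assume "i \<in> {..<n}" "j \<in> {..<n}" "i < j"
    then have "f j < f i" "f i < n" using monotone_onD[OF anti] less by auto
    then show "n - 1 - f i < n - 1 - f j" by linarith
  qed
  from strict_mono_on_lessThan_eq_id[OF this _ \<open>k < n\<close>] have "n - 1 - f k = k"
    using \<open>k < n\<close> by auto
  then show ?thesis using less[OF \<open>k < n\<close>] by linarith
qed

lemma permutes_lessThan_less:
  fixes p :: "nat \<Rightarrow> nat"
  shows "p permutes {..<m} \<Longrightarrow> i < m \<Longrightarrow> p i < m"
  using permutes_nat_less[of p m i] by (simp add: lessThan_atLeast0)

lemma card_subsets_containing: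
  assumes "finite S" "i \<in> S"
  shows "card {A. i \<in> A \<and> A \<subseteq> S} = 2 ^ (card S - 1)"
proof -
  have "{A. i \<in> A \<and> A \<subseteq> S} = insert i ` Pow (S - {i})"
    using assms(2) by (auto intro!: image_eqI[where x = "_ - {i}"])
  moreover have "inj_on (insert i) (Pow (S - {i}))" by (auto simp: inj_on_def)
  ultimately show ?thesis using assms by (simp add: card_image card_Pow)
qed

lemma cube_eqI:
  assumes "x \<in> cube n d" "y \<in> cube n d" "\<And>i. i < d \<Longrightarrow> x ! i = y ! i"
  shows "x = y"
  using assms by (auto simp: cube_iff intro: nth_equalityI)

lemma cube_nth_less: "x \<in> cube n d \<Longrightarrow> i < d \<Longrightarrow> x ! i < n"
  by (simp add: cube_iff)

lemma map_upt_in_cube: "(\<And>i. i < d \<Longrightarrow> f i < n) \<Longrightarrow> map f [0..<d] \<in> cube n d"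
  by (simp add: cube_iff)

locale cube_lines =
  fixes n d :: nat
  assumes n_ge_3: "3 \<le> n" and d_ge_2: "2 \<le> d"
begin

subsection \<open>Opposite values\<close>

definition opp :: "nat \<Rightarrow> nat" where "opp k = n - 1 - k"

lemma n_pos [simp]: "0 < n" using n_ge_3 by simp
lemma one_less_n [simp]: "Suc 0 < n" using n_ge_3 by simp
lemma d_pos [simp]: "0 < d" using d_ge_2 by simp
lemma one_less_d [simp]: "Suc 0 < d" using d_ge_2 by simp

lemma opp_less [simp]: "opp k < n" using n_ge_3 by (simp add: opp_def)
lemma opp_opp [simp]: "k < n \<Longrightarrow> opp (opp k) = k" by (simp add: opp_def)
lemma opp_inject: "k < n \<Longrightarrow> l < n \<Longrightarrow> opp k = opp l \<longleftrightarrow> k = l" by (auto simp: opp_def)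
lemma opp_eq_iff: "k < n \<Longrightarrow> l < n \<Longrightarrow> opp k = l \<longleftrightarrow> k = opp l" by (auto simp: opp_def)
lemma opp_0_neq [simp]: "opp 0 \<noteq> 0" "0 \<noteq> opp 0" using n_ge_3 by (auto simp: opp_def)

lemma opp_0_pos [simp]: "0 < opp 0" using n_ge_3 by (simp add: opp_def)

lemma opp_fixed_unique:
  assumes "opp k = k" "opp l = l" "k < n" "l < n"
  shows "k = l"
  using assms unfolding opp_def by linarith

lemma bij_betw_opp: "bij_betw opp {..<n} {..<n}"
  by (rule bij_betw_byWitness[where f' = opp]) auto

subsection \<open>Lines\<close>

definition support :: "nat list set \<Rightarrow> nat set" where
  "support L = {i. i < d \<and> (\<exists>y\<in>L. \<exists>z\<in>L. y ! i \<noteq> z ! i)}"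

definition direction :: "nat list set \<Rightarrow> (nat \<times> nat) set" where
  "direction L = {(i, j). i \<in> support L \<and> j \<in> support L \<and> (\<forall>z\<in>L. z ! j = z ! i)}"

lemma support_less: "i \<in> support L \<Longrightarrow> i < d"
  by (simp add: support_def)

lemma supportI: "i < d \<Longrightarrow> x \<in> L \<Longrightarrow> y \<in> L \<Longrightarrow> x ! i \<noteq> y ! i \<Longrightarrow> i \<in> support L"
  by (auto simp: support_def)

lemma nth_eq_if_not_support: "i < d \<Longrightarrow> i \<notin> support L \<Longrightarrow> x \<in> L \<Longrightarrow> y \<in> L \<Longrightarrow> x ! i = y ! i"
  unfolding support_def by blast

lemma Domain_direction: "Domain (direction L) = support L"
  by (auto simp: direction_def)

lemma line_in_cube: "is_line n d L \<Longrightarrow> x \<in> L \<Longrightarrow> x \<in> cube n d"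
  by (auto simp: is_line_def)

lemma line_parametrization:
  assumes "is_line n d L"
  obtains q where "L = q ` {..<n}" "support L \<noteq> {}"
    "\<And>i. i \<in> support L \<Longrightarrow> (\<forall>k<n. q k ! i = k) \<or> (\<forall>k<n. q k ! i = opp k)"
proof -
  obtain q where bij: "bij_betw q {..<n} L"
    and mono: "\<forall>i<d. monotone_on {..<n} (<) (<) (\<lambda>k. q k ! i) \<or>
               monotone_on {..<n} (<) (>) (\<lambda>k. q k ! i) \<or> (\<exists>c. \<forall>k<n. q k ! i = c)"
    and nonconst: "\<exists>i<d. \<not> (\<exists>c. \<forall>k<n. q k ! i = c)"
    using assms unfolding is_line_def by blast
  have L: "L = q ` {..<n}" using bij by (simp add: bij_betw_def)
  have less: "q k ! i < n" if "k < n" "i < d" for k i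
    using line_in_cube[OF assms] that by (auto simp: L intro: cube_nth_less)
  have "i \<in> support L \<longleftrightarrow> i < d \<and> (\<exists>k<n. \<exists>l<n. q k ! i \<noteq> q l ! i)" for i
    by (auto simp: support_def L)
  then have support_iff: "i \<in> support L \<longleftrightarrow> i < d \<and> \<not> (\<exists>c. \<forall>k<n. q k ! i = c)" for i
    by (metis n_pos)
  show ?thesis
  proof (rule that[OF L])
    show "support L \<noteq> {}" using nonconst support_iff by blast
    fix i assume "i \<in> support L"
    then have "i < d" "\<not> (\<exists>c. \<forall>k<n. q k ! i = c)" by (simp_all add: support_iff)
    then show "(\<forall>k<n. q k ! i = k) \<or> (\<forall>k<n. q k ! i = opp k)"
      using mono less strict_mono_on_lessThan_eq_id[of n "\<lambda>k. q k ! i"]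
        strict_antimono_on_lessThan_eq[of n "\<lambda>k. q k ! i"] unfolding opp_def by blast
  qed
qed

lemma line_support_nonempty: "is_line n d L \<Longrightarrow> support L \<noteq> {}"
  by (elim line_parametrization)

lemma line_bij_betw_nth:
  assumes "is_line n d L" "i \<in> support L"
  shows "bij_betw (\<lambda>z. z ! i) L {..<n}"
proof -
  obtain q where L: "L = q ` {..<n}" and q: "(\<forall>k<n. q k ! i = k) \<or> (\<forall>k<n. q k ! i = opp k)"
    using line_parametrization assms by metis
  have "bij_betw (\<lambda>k. q k ! i) {..<n} {..<n} \<longleftrightarrow> bij_betw id {..<n} {..<n}"
    if "\<forall>k<n. q k ! i = k"
    using that by (intro bij_betw_cong) auto
  moreover have "bij_betw (\<lambda>k. q k ! i) {..<n} {..<n} \<longleftrightarrow> bij_betw opp {..<n} {..<n}"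
    if "\<forall>k<n. q k ! i = opp k"
    using that by (intro bij_betw_cong) auto
  ultimately have bij: "bij_betw ((\<lambda>z. z ! i) \<circ> q) {..<n} {..<n}"
    using q bij_betw_opp by (auto simp: comp_def)
  then have "bij_betw q {..<n} L"
    unfolding L by (intro inj_on_imp_bij_betw inj_on_imageI2[OF bij_betw_imp_inj_on])
  then show ?thesis using bij bij_betw_comp_iff by blast
qed

lemma line_eq_if_nth_eq:
  assumes "is_line n d L" "i \<in> support L" "x \<in> L" "y \<in> L" "x ! i = y ! i"
  shows "x = y"
  using inj_onD[OF bij_betw_imp_inj_on[OF line_bij_betw_nth]] assms by metis

lemma line_obtain_nth:
  assumes "is_line n d L" "i \<in> support L" "k < n"
  obtains z where "z \<in> L" "z ! i = k"
  using bij_betw_imp_surj_on[OF line_bij_betw_nth[OF assms(1,2)]] assms(3)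
  by (metis imageE lessThan_iff)

lemma line_nth_cases:
  assumes "is_line n d L" "i \<in> support L" "j \<in> support L"
  obtains (equal) "\<And>z. z \<in> L \<Longrightarrow> z ! j = z ! i" | (opposite) "\<And>z. z \<in> L \<Longrightarrow> z ! j = opp (z ! i)"
proof -
  obtain q where "L = q ` {..<n}" "(\<forall>k<n. q k ! i = k) \<or> (\<forall>k<n. q k ! i = opp k)"
    "(\<forall>k<n. q k ! j = k) \<or> (\<forall>k<n. q k ! j = opp k)"
    using line_parametrization assms by metis
  then have "(\<forall>z\<in>L. z ! j = z ! i) \<or> (\<forall>z\<in>L. z ! j = opp (z ! i))" by auto
  then show ?thesis using that by blast
qed

lemma line_nth_eq_opp:
  assumes "is_line n d L" "i \<in> support L" "j \<in> support L" "(i, j) \<notin> direction L" "z \<in> L"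
  shows "z ! j = opp (z ! i)"
  using assms(1-3) by (cases rule: line_nth_cases) (use assms in \<open>auto simp: direction_def\<close>)

lemma is_lineI:
  assumes cube: "L \<subseteq> cube n d" and "i < d" and bij: "bij_betw (\<lambda>z. z ! i) L {..<n}"
    and aligned: "\<And>j. j \<in> support L \<Longrightarrow> (\<forall>z\<in>L. z ! j = z ! i) \<or> (\<forall>z\<in>L. z ! j = opp (z ! i))"
  shows "is_line n d L"
proof -
  define q where "q = inv_into L (\<lambda>z. z ! i)"
  have q: "bij_betw q {..<n} L" unfolding q_def by (rule bij_betw_inv_into[OF bij])
  have q_mem: "q k \<in> L" if "k < n" for k using q that by (auto simp: bij_betw_def)
  have q_nth: "q k ! i = k" if "k < n" for k
    using bij_betw_inv_into_right[OF bij] that by (simp add: q_def)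
  have "monotone_on {..<n} (<) (<) (\<lambda>k. q k ! j) \<or> monotone_on {..<n} (<) (>) (\<lambda>k. q k ! j) \<or>
      (\<exists>c. \<forall>k<n. q k ! j = c)" if "j < d" for j
  proof (cases "j \<in> support L")
    case True
    then have "(\<forall>k<n. q k ! j = k) \<or> (\<forall>k<n. q k ! j = opp k)"
      using aligned[OF True] q_mem q_nth by metis
    then show ?thesis by (auto simp: monotone_on_def opp_def)
  next
    case False
    then show ?thesis using nth_eq_if_not_support[OF that] q_mem n_pos by blast
  qed
  moreover have "q 0 ! i \<noteq> q 1 ! i" using q_nth[of 0] q_nth[of 1] by simp
  then have "\<not> (\<exists>c. \<forall>k<n. q k ! i = c)" using n_pos one_less_n by (metis One_nat_def)
  ultimately show ?thesis unfolding is_line_def using cube q \<open>i < d\<close> by blast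
qed

lemma line_subset_if_direction_eq:
  assumes L: "is_line n d L" "x \<in> L" and M: "is_line n d M" "x \<in> M"
    and eq: "direction L = direction M"
  shows "L \<subseteq> M"
proof
  fix z assume "z \<in> L"
  have supp: "support M = support L" using eq Domain_direction by metis
  obtain i where i: "i \<in> support L" using line_support_nonempty[OF L(1)] by blast
  obtain w where w: "w \<in> M" "w ! i = z ! i"
    using line_obtain_nth[OF M(1)] i supp cube_nth_less line_in_cube[OF L(1) \<open>z \<in> L\<close>] support_less
    by metis
  have "z = w"
  proof (rule cube_eqI)
    show "z \<in> cube n d" "w \<in> cube n d" using L M \<open>z \<in> L\<close> w line_in_cube by blast+
    fix j assume "j < d"
    consider (fixed) "j \<notin> support L" | (equal) "(i, j) \<in> direction L"
      | (opposite) "j \<in> support L" "(i, j) \<notin> direction L"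
      by blast
    then show "z ! j = w ! j"
    proof cases
      case fixed
      then show ?thesis
        using nth_eq_if_not_support[OF \<open>j < d\<close>] L(2) M(2) \<open>z \<in> L\<close> w(1) supp by metis
    next
      case equal
      then have "z ! j = z ! i" "w ! j = w ! i"
        using \<open>z \<in> L\<close> w(1) eq by (auto simp: direction_def)
      then show ?thesis using w(2) by simp
    next
      case opposite
      then have "z ! j = opp (z ! i)" "w ! j = opp (w ! i)"
        using line_nth_eq_opp[OF L(1) i] line_nth_eq_opp[OF M(1), of i j] i \<open>z \<in> L\<close> w(1) eq supp
        by auto
      then show ?thesis using w(2) by simp
    qed
  qed
  then show "z \<in> M" using w by simp
qed

lemma line_eqI_direction:
  assumes "is_line n d L" "x \<in> L" "is_line n d M" "x \<in> M" "direction L = direction M"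
  shows "L = M"
  using assms line_subset_if_direction_eq by (intro equalityI) simp_all

definition differ :: "nat list \<Rightarrow> nat list \<Rightarrow> nat set" where
  "differ x y = {i. i < d \<and> x ! i \<noteq> y ! i}"

lemma finite_differ: "finite (differ x y)"
  by (simp add: differ_def)

lemma differ_empty_iff: "x \<in> cube n d \<Longrightarrow> y \<in> cube n d \<Longrightarrow> differ x y = {} \<longleftrightarrow> x = y"
  by (auto simp: differ_def intro: cube_eqI)

lemma line_support_eq_differ:
  assumes "is_line n d L" "x \<in> L" "y \<in> L" "x \<noteq> y"
  shows "support L = differ x y"
proof -
  have "x ! i \<noteq> y ! i" if "i \<in> support L" for i
    using line_eq_if_nth_eq[OF assms(1) that assms(2,3)] assms(4) by blast
  then show ?thesis using assms(2,3) by (auto simp: differ_def support_less intro: supportI)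
qed

lemma line_direction_eq:
  assumes L: "is_line n d L" and xy: "x \<in> L" "y \<in> L" "x \<noteq> y"
  shows "direction L = {(i, j) \<in> differ x y \<times> differ x y. x ! j = x ! i \<and> y ! j = y ! i}"
proof -
  have "(\<forall>z\<in>L. z ! j = z ! i) \<longleftrightarrow> x ! j = x ! i \<and> y ! j = y ! i"
    if ij: "i \<in> support L" "j \<in> support L" for i j
    using L ij
  proof (cases rule: line_nth_cases)
    case opposite
    have "x ! i \<noteq> y ! i" using line_eq_if_nth_eq[OF L ij(1) xy(1,2)] xy(3) by blast
    moreover have "x ! i < n" "y ! i < n"
      using line_in_cube[OF L] xy support_less[OF ij(1)] cube_nth_less by blast+
    ultimately have "\<not> (x ! j = x ! i \<and> y ! j = y ! i)"
      using opposite xy opp_fixed_unique by metis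
    then show ?thesis using xy by blast
  qed (use xy in blast)
  then show ?thesis
    unfolding direction_def line_support_eq_differ[OF L xy, symmetric] by blast
qed

lemma line_unique:
  assumes "is_line n d L" "is_line n d M" "x \<noteq> y" "x \<in> L" "y \<in> L" "x \<in> M" "y \<in> M"
  shows "L = M"
  using assms by (intro line_eqI_direction[of L x M]) (simp_all add: line_direction_eq[of _ x y])

definition walk :: "nat set \<Rightarrow> nat set \<Rightarrow> nat list \<Rightarrow> nat \<Rightarrow> nat list" where
  "walk A B x k = map (\<lambda>i. if i \<in> A then k else if i \<in> B then opp k else x ! i) [0..<d]"

definition line_along :: "nat set \<Rightarrow> nat set \<Rightarrow> nat list \<Rightarrow> nat list set" where
  "line_along A B x = walk A B x ` {..<n}"

lemma nth_walk [simp]: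
  "i < d \<Longrightarrow> walk A B x k ! i = (if i \<in> A then k else if i \<in> B then opp k else x ! i)"
  by (simp add: walk_def)

lemma walk_in_cube: "x \<in> cube n d \<Longrightarrow> k < n \<Longrightarrow> walk A B x k \<in> cube n d"
  unfolding walk_def by (intro map_upt_in_cube) (simp add: cube_iff)

lemma mem_line_alongI:
  assumes "x \<in> cube n d" "z \<in> cube n d" "k < n"
    and "\<And>i. i < d \<Longrightarrow> z ! i = (if i \<in> A then k else if i \<in> B then opp k else x ! i)"
  shows "z \<in> line_along A B x"
proof -
  have "z = walk A B x k"
    by (rule cube_eqI[OF assms(2) walk_in_cube[OF assms(1,3)]]) (simp add: assms(4))
  then show ?thesis using assms(3) by (simp add: line_along_def)
qed

lemma support_line_along:
  assumes "A \<union> B \<subseteq> {..<d}"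
  shows "support (line_along A B x) = A \<union> B"
proof
  show "A \<union> B \<subseteq> support (line_along A B x)"
  proof
    fix i assume i: "i \<in> A \<union> B"
    then have "i < d" using assms by blast
    then have "walk A B x 0 ! i \<noteq> walk A B x (opp 0) ! i" using i by auto
    then show "i \<in> support (line_along A B x)"
      by (intro supportI[OF \<open>i < d\<close>]) (auto simp: line_along_def)
  qed
qed (auto simp: support_def line_along_def split: if_splits)

lemma is_line_line_along:
  assumes "A \<inter> B = {}" "A \<union> B \<subseteq> {..<d}" "A \<union> B \<noteq> {}" "x \<in> cube n d"
  shows "is_line n d (line_along A B x)"
proof -
  obtain i where i: "i \<in> A \<union> B" "i < d" using assms(2,3) by blast
  have "bij_betw (\<lambda>z. z ! i) (line_along A B x) {..<n}"
    unfolding line_along_def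
  proof (rule bij_betw_imageI)
    show "inj_on (\<lambda>z. z ! i) (walk A B x ` {..<n})"
      using i by (auto simp: inj_on_def opp_inject)
    show "(\<lambda>z. z ! i) ` walk A B x ` {..<n} = {..<n}"
      using i bij_betw_imp_surj_on[OF bij_betw_opp] by (auto simp: image_image)
  qed
  then show ?thesis
  proof (rule is_lineI[rotated 2])
    show "line_along A B x \<subseteq> cube n d" using assms(4) by (auto simp: line_along_def walk_in_cube)
    show "(\<forall>z\<in>line_along A B x. z ! j = z ! i) \<or> (\<forall>z\<in>line_along A B x. z ! j = opp (z ! i))"
      if "j \<in> support (line_along A B x)" for j
    proof -
      have "j \<in> A \<union> B" "j < d" using that assms(2) by (auto simp: support_line_along)
      then show ?thesis using i assms(1) by (auto simp: line_along_def)
    qed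
  qed (fact i)
qed

lemma direction_line_along:
  assumes "A \<inter> B = {}" "A \<union> B \<subseteq> {..<d}"
  shows "direction (line_along A B x) = A \<times> A \<union> B \<times> B"
proof -
  have "(\<forall>k<n. walk A B x k ! j = walk A B x k ! i) \<longleftrightarrow> (i \<in> A \<longleftrightarrow> j \<in> A)"
    if "i \<in> A \<union> B" "j \<in> A \<union> B" for i j
  proof -
    have ij: "i < d" "j < d" using that assms(2) by auto
    show ?thesis
    proof (cases "i \<in> A \<longleftrightarrow> j \<in> A")
      case False
      then have "walk A B x 0 ! j \<noteq> walk A B x 0 ! i" using ij that by auto
      then show ?thesis using False n_pos by blast
    qed (use ij that in auto)
  qed
  then show ?thesis
    unfolding direction_def support_line_along[OF assms(2)] using assms(1)
    by (auto simp: line_along_def)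
qed

lemma line_eq_line_along:
  assumes L: "is_line n d L" "x \<in> L"
  obtains A B where "A \<inter> B = {}" "A \<union> B = support L" "L = line_along A B x"
proof -
  obtain i where i: "i \<in> support L" using line_support_nonempty[OF L(1)] by blast
  define A where "A = {j \<in> support L. \<forall>z\<in>L. z ! j = z ! i}"
  define B where "B = support L - A"
  have AB: "A \<inter> B = {}" "A \<union> B = support L" by (auto simp: A_def B_def)
  have x: "x \<in> cube n d" using line_in_cube[OF L] .
  have "L \<subseteq> line_along A B x"
  proof
    fix z assume z: "z \<in> L"
    show "z \<in> line_along A B x"
    proof (rule mem_line_alongI[OF x line_in_cube[OF L(1) z]])
      show "z ! i < n" using line_in_cube[OF L(1) z] support_less[OF i] by (rule cube_nth_less)
      show "z ! j = (if j \<in> A then z ! i else if j \<in> B then opp (z ! i) else x ! j)"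
        if "j < d" for j
        using line_nth_cases[OF L(1) i, of j] nth_eq_if_not_support[OF that _ z L(2)] z
        by (auto simp: A_def B_def)
    qed
  qed
  moreover obtain y z where "y \<in> L" "z \<in> L" "y \<noteq> z" using i by (auto simp: support_def)
  moreover have "is_line n d (line_along A B x)"
    using AB i x support_less by (intro is_line_line_along) auto
  ultimately have "L = line_along A B x" using line_unique[OF L(1)] by blast
  then show ?thesis using that AB by blast
qed

definition collinear :: "nat list \<Rightarrow> nat list \<Rightarrow> bool" where
  "collinear x y \<longleftrightarrow> (\<exists>L. is_line n d L \<and> x \<in> L \<and> y \<in> L)"

lemma collinear_iff:
  "collinear x y \<longleftrightarrow> x \<in> cube n d \<and> y \<in> cube n d \<and>
     (\<forall>i\<in>differ x y. \<forall>j\<in>differ x y.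
        x ! j = x ! i \<and> y ! j = y ! i \<or> x ! j = opp (x ! i) \<and> y ! j = opp (y ! i))"
    (is "_ \<longleftrightarrow> ?matching")
proof
  assume "collinear x y"
  then obtain L where L: "is_line n d L" "x \<in> L" "y \<in> L" by (auto simp: collinear_def)
  have "x ! j = x ! i \<and> y ! j = y ! i \<or> x ! j = opp (x ! i) \<and> y ! j = opp (y ! i)"
    if "i \<in> differ x y" "j \<in> differ x y" for i j
  proof -
    have "i \<in> support L" "j \<in> support L" using that L by (auto simp: differ_def intro: supportI)
    with L(1) show ?thesis by (cases rule: line_nth_cases) (use L in blast)+
  qed
  then show ?matching using L line_in_cube by blast
next
  assume matching: ?matching
  define i where "i = (if x = y then 0 else SOME i. i \<in> differ x y)"
  have i: "i \<in> differ x y" if "x \<noteq> y"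
    using matching that differ_empty_iff[of x y] by (auto simp: i_def some_in_eq)
  define A where "A = insert i {j \<in> differ x y. x ! j = x ! i \<and> y ! j = y ! i}"
  define B where "B = differ x y - A"
  have "i < d" using i by (cases "x = y") (auto simp: i_def differ_def)
  then have L: "is_line n d (line_along A B x)"
    using matching by (intro is_line_line_along) (auto simp: A_def B_def differ_def)
  have "x ! j = (if j \<in> A then x ! i else if j \<in> B then opp (x ! i) else x ! j)"
    "y ! j = (if j \<in> A then y ! i else if j \<in> B then opp (y ! i) else x ! j)" if "j < d" for j
    using that matching i by (auto simp: A_def B_def differ_def)
  then have "x \<in> line_along A B x" "y \<in> line_along A B x"
    using matching \<open>i < d\<close> cube_nth_less by (blast intro: mem_line_alongI)+
  with L show "collinear x y" by (auto simp: collinear_def)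
qed

lemma collinear_commute: "collinear x y \<longleftrightarrow> collinear y x"
  by (auto simp: collinear_def)

lemma collinear_nth_eq:
  assumes "collinear x y" "i < d" "j < d" "x ! j \<noteq> y ! j" "x ! i \<noteq> x ! j" "x ! i \<noteq> opp (x ! j)"
  shows "x ! i = y ! i"
  using assms by (auto simp: collinear_iff differ_def)

lemma collinear_if_differ_singleton:
  assumes "x \<in> cube n d" "y \<in> cube n d" "differ x y \<subseteq> {i}"
  shows "collinear x y"
  using assms unfolding collinear_iff by blast

lemma collinear_if_opposite:
  assumes "x \<in> cube n d" "y \<in> cube n d" "k < n"
    and "\<And>i. i \<in> differ x y \<Longrightarrow> (x ! i = k \<or> x ! i = opp k) \<and> y ! i = opp (x ! i)"
  shows "collinear x y"
  using assms unfolding collinear_iff by (metis opp_opp)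

subsection \<open>Line permutations\<close>

lemma line_perm_Bij: "T \<in> line_perms n d \<Longrightarrow> T \<in> Bij (cube n d)"
  by (simp add: line_perms_def)

lemma Bij_in_cube: "T \<in> Bij (cube n d) \<Longrightarrow> x \<in> cube n d \<Longrightarrow> T x \<in> cube n d"
  by (auto simp: Bij_def bij_betw_def)

lemmas line_perm_in_cube = Bij_in_cube[OF line_perm_Bij]

lemma line_perm_inj_on: "T \<in> line_perms n d \<Longrightarrow> inj_on T (cube n d)"
  by (simp add: line_perms_def Bij_def bij_betw_def)

lemma line_perm_eq_iff:
  "T \<in> line_perms n d \<Longrightarrow> x \<in> cube n d \<Longrightarrow> y \<in> cube n d \<Longrightarrow> T x = T y \<longleftrightarrow> x = y"
  using line_perm_inj_on by (auto simp: inj_on_def)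

lemma line_perm_line: "T \<in> line_perms n d \<Longrightarrow> is_line n d L \<Longrightarrow> is_line n d (T ` L)"
  by (simp add: line_perms_def)

lemma line_perm_collinear: "T \<in> line_perms n d \<Longrightarrow> collinear x y \<Longrightarrow> collinear (T x) (T y)"
  unfolding collinear_def using line_perm_line by blast

lemma finite_lines: "finite {L. is_line n d L}"
  by (rule finite_subset[of _ "Pow (cube n d)"]) (auto simp: finite_cube line_in_cube)

lemma line_perm_inj_on_lines:
  assumes "T \<in> line_perms n d"
  shows "inj_on ((`) T) {L. is_line n d L}"
  by (rule inj_on_image, rule inj_on_subset[OF line_perm_inj_on[OF assms]])
    (auto simp: line_in_cube)

lemma line_perm_surj_on_lines:
  assumes "T \<in> line_perms n d"
  shows "(`) T ` {L. is_line n d L} = {L. is_line n d L}"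
  using line_perm_line[OF assms]
  by (intro endo_inj_surj finite_lines line_perm_inj_on_lines assms) auto

lemma subgroup_line_perms: "subgroup (line_perms n d) (BijGroup (cube n d))"
proof (rule group.subgroupI[OF group_BijGroup])
  show "line_perms n d \<subseteq> carrier (BijGroup (cube n d))"
    by (auto simp: BijGroup_def line_perm_Bij)
  have "(\<lambda>x\<in>cube n d. x) \<in> line_perms n d"
    unfolding line_perms_def using line_in_cube by (auto simp: id_Bij image_restrict_eq subset_iff)
  then show "line_perms n d \<noteq> {}" by blast
next
  fix T assume T: "T \<in> line_perms n d"
  let ?S = "restrict (inv_into (cube n d) T) (cube n d)"
  have "is_line n d (?S ` L)" if "is_line n d L" for L
  proof -
    have "L \<in> (`) T ` {L. is_line n d L}"
      unfolding line_perm_surj_on_lines[OF T] using that by simp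
    then obtain M where M: "is_line n d M" "L = T ` M" by auto
    have "?S (T x) = x" if "x \<in> M" for x
      using line_in_cube[OF M(1) that] line_perm_in_cube[OF T] line_perm_inj_on[OF T] by simp
    then have "(\<lambda>x. ?S (T x)) ` M = (\<lambda>x. x) ` M" by (rule image_cong[OF refl])
    then have "?S ` L = M" by (simp only: M(2) image_image image_ident)
    then show ?thesis using M by simp
  qed
  then show "inv\<^bsub>BijGroup (cube n d)\<^esub> T \<in> line_perms n d"
    using restrict_inv_into_Bij[OF line_perm_Bij[OF T]] line_perm_Bij[OF T]
    by (simp add: inv_BijGroup line_perms_def)
next
  fix S T assume S: "S \<in> line_perms n d" and T: "T \<in> line_perms n d"
  have "is_line n d (compose (cube n d) S T ` L)" if "is_line n d L" for L
  proof -
    have "compose (cube n d) S T ` L = S ` T ` L"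
      using line_in_cube[OF that] by (auto simp: compose_def image_image)
    then show ?thesis using line_perm_line S T that by simp
  qed
  then have "compose (cube n d) S T \<in> line_perms n d"
    using compose_Bij[OF line_perm_Bij[OF S] line_perm_Bij[OF T]] by (simp add: line_perms_def)
  then show "S \<otimes>\<^bsub>BijGroup (cube n d)\<^esub> T \<in> line_perms n d"
    using line_perm_Bij S T by (simp add: BijGroup_def)
qed

lemma compose_line_perm:
  "S \<in> line_perms n d \<Longrightarrow> T \<in> line_perms n d \<Longrightarrow> compose (cube n d) S T \<in> line_perms n d"
  using subgroup.m_closed[OF subgroup_line_perms, of S T] by (simp add: BijGroup_def line_perm_Bij)

lemma line_perm_inverse:
  assumes T: "T \<in> line_perms n d"
  obtains S where "S \<in> line_perms n d" "\<And>x. x \<in> cube n d \<Longrightarrow> S (T x) = x"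
    "\<And>x. x \<in> cube n d \<Longrightarrow> T (S x) = x"
proof
  let ?S = "inv\<^bsub>BijGroup (cube n d)\<^esub> T"
  show "?S \<in> line_perms n d" using subgroup.m_inv_closed[OF subgroup_line_perms T] .
  have "bij_betw T (cube n d) (cube n d)" using line_perm_Bij[OF T] by (simp add: Bij_def)
  then show "?S (T x) = x" "T (?S x) = x" if "x \<in> cube n d" for x
    using that line_perm_in_cube[OF T that]
    by (simp_all add: inv_BijGroup line_perm_Bij[OF T] bij_betw_inv_into_left
        bij_betw_inv_into_right)
qed

definition doubly_joined :: "nat list set \<Rightarrow> nat list \<Rightarrow> nat list set \<Rightarrow> bool" where
  "doubly_joined X p L \<longleftrightarrow>
     (\<exists>q\<in>L - X. \<exists>q'\<in>L - X. q \<noteq> q' \<and> collinear p q \<and> collinear p q')"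

lemma line_perm_doubly_joined:
  assumes T: "T \<in> line_perms n d" and TX: "\<And>x. x \<in> cube n d \<Longrightarrow> T x \<in> X \<longleftrightarrow> x \<in> X"
    and "is_line n d L" "doubly_joined X p L"
  shows "doubly_joined X (T p) (T ` L)"
proof -
  obtain q q' where q: "q \<in> L - X" "q' \<in> L - X" "q \<noteq> q'" "collinear p q" "collinear p q'"
    using assms(4) by (auto simp: doubly_joined_def)
  then have "q \<in> cube n d" "q' \<in> cube n d" using line_in_cube[OF assms(3)] by auto
  then have "T q \<in> T ` L - X" "T q' \<in> T ` L - X" "T q \<noteq> T q'"
    using q TX line_perm_eq_iff[OF T] by auto
  then show ?thesis
    unfolding doubly_joined_def using line_perm_collinear[OF T] q(4,5) by blast
qed

lemma bij_betw_nth_image: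
  assumes f: "f \<in> Bij (cube n d)" and L: "is_line n d L" and j: "j \<in> support L"
    and g: "bij_betw g {..<n} {..<n}" and nth: "\<forall>x\<in>cube n d. f x ! i = g (x ! j)"
  shows "bij_betw (\<lambda>z. z ! i) (f ` L) {..<n}"
proof -
  have L_cube: "L \<subseteq> cube n d" using line_in_cube[OF L] by blast
  have "bij_betw (g \<circ> (\<lambda>z. z ! j)) L {..<n}"
    by (rule bij_betw_trans[OF line_bij_betw_nth[OF L j] g])
  then have "bij_betw ((\<lambda>z. z ! i) \<circ> f) L {..<n}"
    using nth L_cube by (subst bij_betw_cong[where g = "g \<circ> (\<lambda>z. z ! j)"]) auto
  moreover have "bij_betw f L (f ` L)"
    using f L_cube by (auto simp: Bij_def bij_betw_def intro: inj_on_subset)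
  ultimately show ?thesis using bij_betw_comp_iff by blast
qed

lemma coordinatewise_line_perm:
  assumes f: "f \<in> Bij (cube n d)" and \<sigma>: "\<sigma> permutes {..<d}" and \<pi>: "\<pi> permutes {..<n}"
    and \<pi>_opp: "\<And>k. k < n \<Longrightarrow> \<pi> (opp k) = opp (\<pi> k)"
    and nth: "\<And>i. i < d \<Longrightarrow> (\<forall>x\<in>cube n d. f x ! i = \<pi> (x ! \<sigma> i)) \<or>
                            (\<forall>x\<in>cube n d. f x ! i = opp (\<pi> (x ! \<sigma> i)))"
  shows "f \<in> line_perms n d"
proof -
  have "is_line n d (f ` L)" if L: "is_line n d L" for L
  proof -
    have L_cube: "L \<subseteq> cube n d" using line_in_cube[OF L] by blast
    obtain j where j: "j \<in> support L" using line_support_nonempty[OF L] by blast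
    then obtain i where i: "i < d" "\<sigma> i = j"
      using permutes_image[OF \<sigma>] support_less by (metis imageE lessThan_iff)
    have "bij_betw \<pi> {..<n} {..<n}" by (rule permutes_imp_bij[OF \<pi>])
    then have "bij_betw g {..<n} {..<n}" if "g = \<pi> \<or> g = opp \<circ> \<pi>" for g
      using that bij_betw_trans[OF _ bij_betw_opp] by blast
    moreover have "\<exists>g. (g = \<pi> \<or> g = opp \<circ> \<pi>) \<and> (\<forall>x\<in>cube n d. f x ! i = g (x ! j))"
      using nth[OF i(1)] i(2) by fastforce
    ultimately have "bij_betw (\<lambda>z. z ! i) (f ` L) {..<n}"
      using bij_betw_nth_image[OF f L j] by blast
    then show ?thesis
    proof (rule is_lineI[OF _ i(1), rotated])
      show "f ` L \<subseteq> cube n d" using L_cube Bij_in_cube[OF f] by blast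
      fix b assume b: "b \<in> support (f ` L)"
      then have "b < d" by (rule support_less)
      obtain y z where yz: "y \<in> L" "z \<in> L" "f y ! b \<noteq> f z ! b" using b by (auto simp: support_def)
      then have "y ! \<sigma> b \<noteq> z ! \<sigma> b" using nth[OF \<open>b < d\<close>] L_cube by (metis subsetD)
      then have "\<sigma> b \<in> support L" using permutes_lessThan_less[OF \<sigma> \<open>b < d\<close>] yz by (intro supportI)
      with L j have "(\<forall>z\<in>L. z ! \<sigma> b = z ! j) \<or> (\<forall>z\<in>L. z ! \<sigma> b = opp (z ! j))"
        by (cases rule: line_nth_cases) blast+
      moreover have "z ! j < n" if "z \<in> L" for z
        using that L_cube support_less[OF j] cube_nth_less by blast
      ultimately show "(\<forall>z\<in>f ` L. z ! b = z ! i) \<or> (\<forall>z\<in>f ` L. z ! b = opp (z ! i))"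
        using nth[OF \<open>b < d\<close>] nth[OF i(1)] i(2) L_cube \<pi>_opp permutes_lessThan_less[OF \<pi>]
        by (auto simp: subset_iff)
    qed
  qed
  then show ?thesis using f by (simp add: line_perms_def)
qed

subsection \<open>The group generated by rotations, coordinate maps and the swap\<close>

lemma coord_map_nth: "x \<in> cube n d \<Longrightarrow> i < d \<Longrightarrow> coord_map n d \<pi> x ! i = \<pi> (x ! i)"
  by (simp add: coord_map_def cube_iff)

lemma coord_group_iff:
  "f \<in> coord_group n d \<longleftrightarrow>
     (\<exists>\<pi>. f = coord_map n d \<pi> \<and> \<pi> permutes {..<n} \<and> (\<forall>k<n. \<pi> (opp k) = opp (\<pi> k)))"
  by (simp add: coord_group_def opp_def)

definition signed_perm :: "(nat \<Rightarrow> nat) \<Rightarrow> nat set \<Rightarrow> nat list \<Rightarrow> nat list" where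
  "signed_perm \<sigma> S =
     (\<lambda>x \<in> cube n d. map (\<lambda>i. if i \<in> S then opp (x ! \<sigma> i) else x ! \<sigma> i) [0..<d])"

lemma signed_perm_nth:
  "x \<in> cube n d \<Longrightarrow> i < d \<Longrightarrow>
     signed_perm \<sigma> S x ! i = (if i \<in> S then opp (x ! \<sigma> i) else x ! \<sigma> i)"
  by (simp add: signed_perm_def)

lemma signed_perm_in_cube:
  assumes "\<sigma> permutes {..<d}" "x \<in> cube n d"
  shows "signed_perm \<sigma> S x \<in> cube n d"
proof -
  have "x ! \<sigma> i < n" if "i < d" for i
    by (intro cube_nth_less[OF assms(2)] permutes_lessThan_less[OF assms(1) that])
  then show ?thesis using assms(2) by (auto simp: signed_perm_def intro!: map_upt_in_cube)
qed

lemma compose_signed_perm: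
  assumes \<sigma>: "\<sigma> permutes {..<d}" and \<tau>: "\<tau> permutes {..<d}"
  shows "compose (cube n d) (signed_perm \<sigma> S) (signed_perm \<tau> R) =
    signed_perm (\<tau> \<circ> \<sigma>) (sym_diff S (\<sigma> -` R))"
proof (rule extensionalityI)
  fix x assume x: "x \<in> cube n d"
  have \<tau>x: "signed_perm \<tau> R x \<in> cube n d" by (rule signed_perm_in_cube[OF \<tau> x])
  show "compose (cube n d) (signed_perm \<sigma> S) (signed_perm \<tau> R) x =
      signed_perm (\<tau> \<circ> \<sigma>) (sym_diff S (\<sigma> -` R)) x"
    unfolding compose_eq[OF x]
  proof (rule cube_eqI)
    fix i assume "i < d"
    then have "\<sigma> i < d" "\<tau> (\<sigma> i) < d"
      by (simp_all add: permutes_lessThan_less[OF \<sigma>] permutes_lessThan_less[OF \<tau>])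
    then show "signed_perm \<sigma> S (signed_perm \<tau> R x) ! i =
        signed_perm (\<tau> \<circ> \<sigma>) (sym_diff S (\<sigma> -` R)) x ! i"
      using \<open>i < d\<close> x \<tau>x cube_nth_less[OF x] by (simp add: signed_perm_nth)
  qed (use signed_perm_in_cube permutes_compose \<sigma> \<tau> x \<tau>x in blast)+
qed (auto simp: signed_perm_def)

lemma signed_perm_eqI:
  assumes "\<sigma> permutes {..<d}" "f \<in> extensional (cube n d)"
    and "\<And>x. x \<in> cube n d \<Longrightarrow> f x \<in> cube n d"
    and "\<And>x i. x \<in> cube n d \<Longrightarrow> i < d \<Longrightarrow> f x ! i = (if i \<in> S then opp (x ! \<sigma> i) else x ! \<sigma> i)"
  shows "f = signed_perm \<sigma> S"
  using assms(2)
proof (rule extensionalityI)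
  show "f x = signed_perm \<sigma> S x" if "x \<in> cube n d" for x
    by (rule cube_eqI[OF assms(3)[OF that] signed_perm_in_cube[OF assms(1) that]])
      (simp add: that assms(4) signed_perm_nth)
qed (simp add: signed_perm_def)

lemma rot_eq_signed_perm:
  assumes "i < d" "j < d" "i \<noteq> j"
  shows "rot n d i j = signed_perm (transpose i j) {i}"
proof (rule signed_perm_eqI)
  show "transpose i j permutes {..<d}" using assms by (intro permutes_swap_id) auto
  show "rot n d i j x \<in> cube n d" if "x \<in> cube n d" for x
    by (rule Bij_in_cube[OF rot_Bij that]) fact+
qed (use assms in \<open>auto simp: rot_def cube_iff nth_list_update opp_def transpose_def\<close>)

lemma swap_last_eq_signed_perm: "swap_last n d = signed_perm (transpose (d - 2) (d - 1)) {}"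
proof (rule signed_perm_eqI)
  show "transpose (d - 2) (d - 1) permutes {..<d}" by (intro permutes_swap_id) auto
  show "swap_last n d x \<in> cube n d" if "x \<in> cube n d" for x
    by (rule Bij_in_cube[OF swap_last_Bij[OF d_ge_2] that])
qed (use d_ge_2 in \<open>auto simp: swap_last_def cube_iff nth_list_update transpose_def\<close>)

lemma aut_group_Bij: "A \<in> aut_group n d \<Longrightarrow> A \<in> Bij (cube n d)"
  using subgroup.mem_carrier[OF subgroup_aut_group[OF d_ge_2]] by (auto simp: BijGroup_def)

lemma compose_aut_group:
  "A \<in> aut_group n d \<Longrightarrow> B \<in> aut_group n d \<Longrightarrow> compose (cube n d) A B \<in> aut_group n d"
  using subgroup.m_closed[OF subgroup_aut_group[OF d_ge_2], of A n B]
  by (simp add: BijGroup_def aut_group_Bij)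

lemma id_aut_group: "(\<lambda>x\<in>cube n d. x) \<in> aut_group n d"
  using subgroup.one_closed[OF subgroup_aut_group[OF d_ge_2], of n] by (simp add: BijGroup_def)

lemma rot_aut_group:
  assumes "i < d" "j < d" "i \<noteq> j"
  shows "rot n d i j \<in> aut_group n d"
  unfolding aut_group_def rot_group_def using assms by (blast intro: generate.incl)

lemma swap_last_aut_group: "swap_last n d \<in> aut_group n d"
  unfolding aut_group_def swap_group_def by (blast intro: generate.incl)

lemma coord_group_subset_aut_group: "coord_group n d \<subseteq> aut_group n d"
  unfolding aut_group_def by (blast intro: generate.incl)

lemma aut_group_subset_line_perms: "aut_group n d \<subseteq> line_perms n d"
proof -
  note generate_subset = group.generate_subgroup_incl[OF group_BijGroup _ subgroup_line_perms]
  have signed: "f \<in> line_perms n d"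
    if "f \<in> Bij (cube n d)" "f = signed_perm (transpose i j) S" "i < d" "j < d" for f i j S
  proof (rule coordinatewise_line_perm[OF that(1) _ permutes_id])
    show "transpose i j permutes {..<d}" using that by (intro permutes_swap_id) auto
  qed (auto simp: that(2) signed_perm_nth)
  have "rot n d i j \<in> line_perms n d" if "i < d" "j < d" "i \<noteq> j" for i j
    using signed[OF rot_Bij rot_eq_signed_perm] that by blast
  then have "rot_group n d \<subseteq> line_perms n d"
    unfolding rot_group_def by (intro generate_subset) blast
  moreover have "coord_group n d \<subseteq> line_perms n d"
  proof
    fix f assume "f \<in> coord_group n d"
    then obtain \<pi> where "f \<in> Bij (cube n d)" "f = coord_map n d \<pi>" "\<pi> permutes {..<n}"
        "\<And>k. k < n \<Longrightarrow> \<pi> (opp k) = opp (\<pi> k)"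
      using coord_group_Bij coord_group_iff by blast
    then show "f \<in> line_perms n d"
      by (intro coordinatewise_line_perm[OF _ permutes_id, where \<pi> = \<pi>]) (auto simp: coord_map_nth)
  qed
  moreover have "swap_last n d \<in> line_perms n d"
    using signed[OF swap_last_Bij swap_last_eq_signed_perm] d_ge_2 by simp
  then have "swap_group n d \<subseteq> line_perms n d"
    using subgroup.one_closed[OF subgroup_line_perms] by (auto simp: swap_group_def)
  ultimately show ?thesis unfolding aut_group_def by (intro generate_subset) blast
qed

lemma reflect_last_aut_group: "signed_perm id {d - 1} \<in> aut_group n d"
proof -
  have last: "d - 2 < d" "d - 1 < d" "d - 2 \<noteq> d - 1" using d_ge_2 by auto
  have \<tau>: "transpose (d - 2) (d - 1) permutes {..<d}" by (intro permutes_swap_id) auto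
  have "compose (cube n d) (swap_last n d) (rot n d (d - 2) (d - 1)) = signed_perm id {d - 1}"
    unfolding swap_last_eq_signed_perm rot_eq_signed_perm[OF last] compose_signed_perm[OF \<tau> \<tau>]
    using last
    by (intro arg_cong2[of _ _ _ _ signed_perm]) (auto simp: transpose_def split: if_splits)
  then show ?thesis
    using compose_aut_group[OF swap_last_aut_group rot_aut_group[OF last]] by simp
qed

lemma reflect_aut_group:
  assumes "i < d"
  shows "signed_perm id {i} \<in> aut_group n d"
proof (cases "i = d - 1")
  case False
  let ?\<tau> = "transpose i (d - 1)"
  have last: "d - 1 < d" by simp
  have \<tau>: "?\<tau> permutes {..<d}" "transpose (d - 1) i permutes {..<d}"
    using assms by (auto intro!: permutes_swap_id)
  have "compose (cube n d) (signed_perm id {d - 1}) (rot n d i (d - 1)) = signed_perm ?\<tau> {i, d - 1}"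
    unfolding rot_eq_signed_perm[OF assms last False] compose_signed_perm[OF permutes_id \<tau>(1)]
    using False by (intro arg_cong2[of _ _ _ _ signed_perm]) auto
  moreover have "compose (cube n d) (rot n d (d - 1) i) (signed_perm ?\<tau> {i, d - 1}) =
      signed_perm id {i}"
    unfolding rot_eq_signed_perm[OF last assms False[symmetric]] compose_signed_perm[OF \<tau>(2,1)]
    using False
    by (intro arg_cong2[of _ _ _ _ signed_perm]) (auto simp: transpose_def split: if_splits)
  ultimately show ?thesis
    using compose_aut_group reflect_last_aut_group rot_aut_group[OF assms last False]
      rot_aut_group[OF last assms False[symmetric]] by metis
qed (use reflect_last_aut_group in simp)

lemma reflections_aut_group:
  assumes "S \<subseteq> {..<d}"
  shows "signed_perm id S \<in> aut_group n d"
proof -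
  have "finite S" using assms finite_subset by blast
  then show ?thesis using assms
  proof (induction S rule: finite_induct)
    case empty
    have "(\<lambda>x\<in>cube n d. x) = signed_perm id {}"
      by (rule signed_perm_eqI) (auto simp: permutes_id)
    then show ?case using id_aut_group by metis
  next
    case (insert i S)
    have "compose (cube n d) (signed_perm id {i}) (signed_perm id S) = signed_perm id (insert i S)"
      unfolding compose_signed_perm[OF permutes_id permutes_id]
      using insert.hyps by (intro arg_cong2[of _ _ _ _ signed_perm]) auto
    then show ?case using compose_aut_group[OF reflect_aut_group] insert by fastforce
  qed
qed

lemma transpose_aut_group:
  assumes "i < d" "j < d" "i \<noteq> j"
  shows "signed_perm (transpose i j) {} \<in> aut_group n d"
proof -
  have "transpose i j permutes {..<d}" using assms by (intro permutes_swap_id) auto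
  then have "compose (cube n d) (signed_perm id {i}) (rot n d i j) = signed_perm (transpose i j) {}"
    by (simp add: rot_eq_signed_perm[OF assms] compose_signed_perm permutes_id)
  then show ?thesis using compose_aut_group[OF reflect_aut_group rot_aut_group] assms by metis
qed

lemma permute_aut_group:
  assumes "\<sigma> permutes {..<d}"
  shows "signed_perm \<sigma> {} \<in> aut_group n d"
  using assms finite_lessThan
proof (induction \<sigma> rule: permutes_induct)
  case id
  show ?case using reflections_aut_group by blast
next
  case (swap i j \<sigma>)
  then have "transpose i j permutes {..<d}" by (intro permutes_swap_id)
  then have "compose (cube n d) (signed_perm \<sigma> {}) (signed_perm (transpose i j) {}) =
      signed_perm (transpose i j \<circ> \<sigma>) {}"
    by (simp add: compose_signed_perm swap)
  then show ?case
    using compose_aut_group[OF swap.IH transpose_aut_group] swap by (metis lessThan_iff)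
qed

subsection \<open>Diagonal points\<close>

definition pencil :: "nat list \<Rightarrow> nat list set set" where
  "pencil x = {L. is_line n d L \<and> x \<in> L}"

lemma finite_pencil [simp]: "finite (pencil x)"
  by (rule finite_subset[OF _ finite_lines]) (auto simp: pencil_def)

lemma line_perm_inj_on_pencil: "T \<in> line_perms n d \<Longrightarrow> inj_on ((`) T) (pencil x)"
  by (rule inj_on_subset[OF line_perm_inj_on_lines]) (auto simp: pencil_def)

lemma card_pencil_le_line_perm:
  assumes "T \<in> line_perms n d"
  shows "card (pencil x) \<le> card (pencil (T x))"
  using line_perm_line[OF assms]
  by (intro card_inj_on_le[OF line_perm_inj_on_pencil[OF assms] _ finite_pencil])
    (auto simp: pencil_def)

definition diagonal :: "nat list \<Rightarrow> bool" where
  "diagonal x \<longleftrightarrow> x \<in> cube n d \<and> (\<forall>i<d. \<forall>j<d. x ! j = x ! i \<or> x ! j = opp (x ! i))"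

lemma diagonal_in_cube: "diagonal x \<Longrightarrow> x \<in> cube n d"
  by (simp add: diagonal_def)

lemma diagonal_obtain_line:
  assumes x: "diagonal x" and S: "S \<subseteq> {..<d}" "S \<noteq> {}"
  obtains L where "L \<in> pencil x" "support L = S"
proof -
  obtain i where i: "i \<in> S" "i < d" using S by blast
  define A where "A = {j \<in> S. x ! j = x ! i}"
  have x_cube: "x \<in> cube n d" using x by (rule diagonal_in_cube)
  have "x \<in> line_along A (S - A) x"
  proof (rule mem_line_alongI[OF x_cube x_cube cube_nth_less[OF x_cube i(2)]])
    show "x ! j = (if j \<in> A then x ! i else if j \<in> S - A then opp (x ! i) else x ! j)"
      if "j < d" for j
      using x i(2) that by (auto simp: A_def diagonal_def)
  qed
  moreover have split: "A \<inter> (S - A) = {}" "A \<union> (S - A) = S" by (auto simp: A_def)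
  then have "is_line n d (line_along A (S - A) x)"
    using S x_cube by (intro is_line_line_along) blast+
  ultimately have "line_along A (S - A) x \<in> pencil x" by (simp add: pencil_def)
  moreover have "support (line_along A (S - A) x) = S"
    using S split(2) by (simp only: support_line_along)
  ultimately show ?thesis using that by blast
qed

lemma full_line_diagonal:
  assumes "is_line n d L" "support L = {..<d}" "x \<in> L"
  shows "diagonal x"
proof -
  have "x ! j = x ! i \<or> x ! j = opp (x ! i)" if "i < d" "j < d" for i j
    using assms(1) by (cases rule: line_nth_cases[of L i j]) (use assms that in auto)
  then show ?thesis using assms line_in_cube by (simp add: diagonal_def)
qed

lemma full_line_iff:
  assumes L: "is_line n d L"
  shows "support L = {..<d} \<longleftrightarrow> (\<forall>x\<in>L. diagonal x)"
proof (intro iffI ballI full_line_diagonal[OF L])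
  assume all_diagonal: "\<forall>x\<in>L. diagonal x"
  obtain i where i: "i \<in> support L" using line_support_nonempty[OF L] by blast
  obtain z where z: "z \<in> L" using line_obtain_nth[OF L i n_pos] .
  have "j \<in> support L" if "j < d" for j
  proof (rule ccontr)
    assume j: "j \<notin> support L"
    have "z ! j < n" using cube_nth_less[OF line_in_cube[OF L z] that] .
    then have "\<exists>m<n. m \<noteq> z ! j \<and> m \<noteq> opp (z ! j)"
      using n_ge_3
      by (intro exI[of _ "if z ! j = 0 \<or> z ! j = opp 0 then 1 else 0"]) (auto simp: opp_def)
    then obtain m where m: "m < n" "m \<noteq> z ! j" "m \<noteq> opp (z ! j)" by blast
    obtain y where y: "y \<in> L" "y ! i = m" using line_obtain_nth[OF L i m(1)] .
    have "y ! j = z ! j" using nth_eq_if_not_support[OF that j y(1) z] .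
    then show False using all_diagonal y m support_less[OF i] that unfolding diagonal_def by metis
  qed
  then show "support L = {..<d}" using support_less by blast
qed

subsubsection \<open>Even side length\<close>

lemma inj_on_support_pencil:
  assumes x: "\<And>i. i < d \<Longrightarrow> opp (x ! i) \<noteq> x ! i"
  shows "inj_on support (pencil x)"
proof (rule inj_onI)
  fix L M assume L: "L \<in> pencil x" and M: "M \<in> pencil x" and supp: "support L = support M"
  have direction: "direction K = {(i, j) \<in> support K \<times> support K. x ! j = x ! i}"
    if K: "K \<in> pencil x" for K
  proof -
    have line: "is_line n d K" "x \<in> K" using K by (auto simp: pencil_def)
    have "x ! j \<noteq> x ! i" if "i \<in> support K" "j \<in> support K" "(i, j) \<notin> direction K" for i j
      using line_nth_eq_opp[OF line(1) that line(2)] x[OF support_less[OF that(1)]] by simp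
    then show ?thesis using line by (auto simp: direction_def)
  qed
  then have "direction L = direction M" using direction[OF L] direction[OF M] supp by simp
  then show "L = M" using L M line_eqI_direction by (auto simp: pencil_def)
qed

lemma diagonal_iff_card_pencil:
  assumes even: "\<And>k. k < n \<Longrightarrow> opp k \<noteq> k" and x: "x \<in> cube n d"
  shows "diagonal x \<longleftrightarrow> card (Pow {..<d} - {{}}) \<le> card (pencil x)"
proof -
  let ?P = "Pow {..<d} - {{}}"
  have "inj_on support (pencil x)"
    using even cube_nth_less[OF x] by (intro inj_on_support_pencil) blast
  then have card: "card (pencil x) = card (support ` pencil x)" by (simp add: card_image)
  have sub: "support ` pencil x \<subseteq> ?P"
    using line_support_nonempty support_less by (auto simp: pencil_def)
  show ?thesis
  proof
    assume x: "diagonal x"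
    have "S \<in> support ` pencil x" if "S \<in> ?P" for S
      using diagonal_obtain_line[OF x, of S] that by (auto intro: rev_image_eqI)
    then show "card ?P \<le> card (pencil x)" unfolding card by (intro card_mono) auto
  next
    assume "card ?P \<le> card (pencil x)"
    then have "support ` pencil x = ?P" using sub unfolding card by (intro card_seteq) auto
    moreover have "{..<d} \<in> ?P" by (auto simp: lessThan_empty_iff)
    ultimately obtain L where "L \<in> pencil x" "support L = {..<d}" by (metis imageE)
    then show "diagonal x" using full_line_diagonal by (auto simp: pencil_def)
  qed
qed

lemma line_perm_diagonal_even:
  assumes "T \<in> line_perms n d" "\<And>k. k < n \<Longrightarrow> opp k \<noteq> k" "diagonal x"
  shows "diagonal (T x)"
proof -
  have x: "x \<in> cube n d" using assms(3) by (rule diagonal_in_cube)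
  have "card (Pow {..<d} - {{}}) \<le> card (pencil x)"
    using diagonal_iff_card_pencil[OF assms(2) x] assms(3) by blast
  also have "\<dots> \<le> card (pencil (T x))" by (rule card_pencil_le_line_perm[OF assms(1)])
  finally show ?thesis
    using diagonal_iff_card_pencil[OF assms(2) line_perm_in_cube[OF assms(1) x]] by blast
qed

end

subsubsection \<open>Odd side length\<close>

locale odd_cube_lines = cube_lines +
  fixes h :: nat
  assumes h_less [simp]: "h < n" and opp_h [simp]: "opp h = h"
begin

abbreviation center :: "nat list" where "center \<equiv> replicate d h"

lemma center_in_cube [simp]: "center \<in> cube n d"
  by (simp add: cube_iff)

lemma neq_center_iff: "x \<in> cube n d \<Longrightarrow> x \<noteq> center \<longleftrightarrow> (\<exists>i<d. x ! i \<noteq> h)"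
  using cube_eqI[OF _ center_in_cube] by auto

lemma nth_eq_h_if_opp_eq: "k < n \<Longrightarrow> opp k = k \<Longrightarrow> k = h"
  by (rule opp_fixed_unique) simp_all

lemma line_along_center:
  assumes "A \<inter> B = {}" "A \<union> B \<subseteq> {..<d}" "A \<union> B \<noteq> {}"
  shows "line_along A B center \<in> pencil center"
  using is_line_line_along[OF assms center_in_cube]
  by (auto simp: pencil_def intro!: mem_line_alongI[of _ _ h])

lemma direction_pencil_subset_center: "direction ` pencil x \<subseteq> direction ` pencil center"
proof (rule image_subsetI)
  fix L assume "L \<in> pencil x"
  then have L: "is_line n d L" "x \<in> L" by (auto simp: pencil_def)
  obtain A B where AB: "A \<inter> B = {}" "A \<union> B = support L" "L = line_along A B x"
    using line_eq_line_along[OF L] .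
  have less: "A \<union> B \<subseteq> {..<d}" using AB(2) support_less by auto
  have "direction (line_along A B center) = direction L"
    unfolding AB(3) direction_line_along[OF AB(1) less] ..
  moreover have "line_along A B center \<in> pencil center"
    using line_along_center[OF AB(1) less] line_support_nonempty[OF L(1)] AB(2) by simp
  ultimately show "direction L \<in> direction ` pencil center" by (metis imageI)
qed

lemma inj_on_direction_pencil: "inj_on direction (pencil x)"
  using line_eqI_direction by (auto simp: inj_on_def pencil_def)

text \<open>A point whose coordinates at \<open>i\<close> and \<open>j\<close> both equal and oppose each other is central there,
  so another point misses one of the two directions supported by \<open>{i, j}\<close>.\<close>

lemma card_pencil_less_center:
  assumes x: "x \<in> cube n d" "x \<noteq> center"
  shows "card (pencil x) < card (pencil center)"
proof -
  obtain i where i: "i < d" "x ! i \<noteq> h" using neq_center_iff[OF x(1)] x(2) by blast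
  define j where "j = (if i = 0 then Suc 0 else 0)"
  have j: "j < d" "j \<noteq> i" by (auto simp: j_def)
  have "x ! i = h"
    if onto: "direction ` pencil x = direction ` pencil center"
  proof -
    have mem: "direction (line_along A B center) \<in> direction ` pencil x"
      if "A \<inter> B = {}" "A \<union> B = {i, j}" for A B
      unfolding onto using that i j by (intro imageI line_along_center) auto
    obtain L where L: "L \<in> pencil x" "direction L = {i, j} \<times> {i, j}"
      using mem[of "{i, j}" "{}"] i j by (auto simp: direction_line_along)
    obtain M where M: "M \<in> pencil x" "direction M = {i} \<times> {i} \<union> {j} \<times> {j}"
      using mem[of "{i}" "{j}"] i j by (auto simp: direction_line_along)
    have "x ! j = x ! i" using L by (auto simp: direction_def pencil_def)
    moreover have "x ! j = opp (x ! i)"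
    proof (rule line_nth_eq_opp)
      show "is_line n d M" "x \<in> M" using M by (auto simp: pencil_def)
      show "i \<in> support M" "j \<in> support M" using M(2) Domain_direction[of M] by auto
      show "(i, j) \<notin> direction M" using M(2) j by auto
    qed
    ultimately show ?thesis using nth_eq_h_if_opp_eq cube_nth_less[OF x(1) i(1)] by simp
  qed
  then have "direction ` pencil x \<subset> direction ` pencil center"
    using direction_pencil_subset_center i(2) by blast
  then have "card (direction ` pencil x) < card (direction ` pencil center)"
    by (intro psubset_card_mono) simp_all
  then show ?thesis by (simp add: card_image inj_on_direction_pencil)
qed

lemma line_perm_center:
  assumes "T \<in> line_perms n d"
  shows "T center = center"
  using card_pencil_less_center[OF line_perm_in_cube[OF assms center_in_cube]]
    card_pencil_le_line_perm[OF assms, of center] by fastforce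

lemma line_perm_eq_center_iff:
  assumes "T \<in> line_perms n d" "x \<in> cube n d"
  shows "T x = center \<longleftrightarrow> x = center"
  using line_perm_eq_iff[OF assms center_in_cube] line_perm_center[OF assms(1)] by simp

lemma nth_eq_h_iff_not_support:
  assumes "L \<in> pencil center" "q \<in> L" "q \<noteq> center" "i < d"
  shows "q ! i = h \<longleftrightarrow> i \<notin> support L"
proof -
  have L: "is_line n d L" "center \<in> L" using assms(1) by (auto simp: pencil_def)
  show ?thesis
    using line_eq_if_nth_eq[OF L(1) _ assms(2) L(2), of i] assms(3,4)
      nth_eq_if_not_support[OF assms(4) _ assms(2) L(2)] by auto
qed

lemma doubly_joined_support:
  assumes p: "p \<in> cube n d" "p \<noteq> center"
    and L: "L \<in> pencil center" and joined: "doubly_joined {center} p L"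
  shows "support L = {i. i < d \<and> p ! i \<noteq> h}"
proof -
  obtain q q' where q: "q \<in> L" "q' \<in> L" "q \<noteq> q'" "q \<noteq> center" "q' \<noteq> center"
    "collinear q p" "collinear q' p"
    using joined by (auto simp: doubly_joined_def collinear_commute)
  have line: "is_line n d L" using L by (simp add: pencil_def)
  have q_eq: "q = q'" if "j \<in> support L" "q ! j = q' ! j" for j
    using line_eq_if_nth_eq[OF line that(1) q(1,2) that(2)] .
  note h_iff = nth_eq_h_iff_not_support[OF L]
  have "p ! i = h" if i: "i < d" "i \<notin> support L" for i
  proof (rule ccontr)
    assume pi: "p ! i \<noteq> h"
    obtain j where j: "j \<in> support L" using line_support_nonempty[OF line] by blast
    have "u ! j = p ! j" if u: "u \<in> L" "u \<noteq> center" "collinear u p" for u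
      using collinear_nth_eq[OF u(3) support_less[OF j] i(1)]
        h_iff[OF u(1,2) i(1)] h_iff[OF u(1,2) support_less[OF j]] i(2) j pi by simp
    then show False using q_eq[OF j] q by simp
  qed
  moreover have "p ! i \<noteq> h" if i: "i \<in> support L" for i
  proof
    assume pi: "p ! i = h"
    have "u ! j = p ! j" if u: "u \<in> L" "u \<noteq> center" "collinear u p" and j: "j < d" "p ! j \<noteq> h"
      for u j
      using collinear_nth_eq[OF u(3)[unfolded collinear_commute[of u]] j(1) support_less[OF i]]
        h_iff[OF u(1,2) support_less[OF i]] i j pi by simp
    then have "p ! j = h" if "j < d" "j \<in> support L" for j using q_eq that q by metis
    then have "p ! j = h" if "j < d" for j using that calculation by blast
    then show False using neq_center_iff[OF p(1)] p(2) by blast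
  qed
  ultimately show ?thesis using support_less by blast
qed

lemma full_line_doubly_joined:
  assumes p: "diagonal p" "p \<noteq> center" and L: "L \<in> pencil center" "support L = {..<d}"
  shows "doubly_joined {center} p L"
proof -
  have line: "is_line n d L" using L by (simp add: pencil_def)
  have p_cube: "p \<in> cube n d" using p(1) by (rule diagonal_in_cube)
  define k where "k = p ! 0"
  have k: "k < n" using cube_nth_less[OF p_cube d_pos] by (simp add: k_def)
  have p_nth: "p ! i = k \<or> p ! i = opp k" if "i < d" for i
    using p(1) that d_pos unfolding diagonal_def k_def by blast
  have "k \<noteq> h" using p_nth neq_center_iff[OF p_cube] p(2) by auto
  then have k_opp: "opp k \<noteq> k" "opp k \<noteq> h" using k nth_eq_h_if_opp_eq opp_eq_iff[of k h] by auto
  obtain q where q: "q \<in> L" "q ! 0 = k" using line_obtain_nth[OF line, of 0 k] L(2) k by auto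
  obtain q' where q': "q' \<in> L" "q' ! 0 = opp k"
    using line_obtain_nth[OF line, of 0 "opp k"] L(2) by auto
  have "collinear p u" if u: "u \<in> L" "u ! 0 = k \<or> u ! 0 = opp k" for u
  proof (rule collinear_if_opposite[OF p_cube line_in_cube[OF line u(1)] k])
    fix i assume i: "i \<in> differ p u"
    then have "i < d" "p ! i \<noteq> u ! i" by (auto simp: differ_def)
    moreover have "u ! i = u ! 0 \<or> u ! i = opp (u ! 0)"
      using full_line_diagonal[OF line L(2) u(1)] \<open>i < d\<close> d_pos unfolding diagonal_def by blast
    ultimately show "(p ! i = k \<or> p ! i = opp k) \<and> u ! i = opp (p ! i)"
      using u(2) p_nth[of i] k by auto
  qed
  moreover have "q \<noteq> q'" "q \<noteq> center" "q' \<noteq> center" using q q' \<open>k \<noteq> h\<close> k_opp by auto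
  ultimately show ?thesis unfolding doubly_joined_def using q q' by blast
qed

lemma card_center_lines_with_support:
  assumes "S \<subseteq> {..<d}" "i \<in> S"
  shows "card {L \<in> pencil center. support L = S} = 2 ^ (card S - 1)"
proof -
  let ?P = "{L \<in> pencil center. support L = S}" and ?class = "\<lambda>L. direction L `` {i}"
  have class_bounds: "i \<in> ?class L \<and> ?class L \<subseteq> S"
    and direction_eq: "direction L = ?class L \<times> ?class L \<union> (S - ?class L) \<times> (S - ?class L)"
    if "L \<in> ?P" for L
  proof -
    have L: "is_line n d L" "center \<in> L" "support L = S" using that by (auto simp: pencil_def)
    obtain A B where AB: "A \<inter> B = {}" "A \<union> B = S" "L = line_along A B center"
      using line_eq_line_along[OF L(1,2)] L(3) by metis
    have "direction L = A \<times> A \<union> B \<times> B"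
      unfolding AB(3) using AB(2) assms(1) by (intro direction_line_along AB(1)) blast
    then show "i \<in> ?class L \<and> ?class L \<subseteq> S"
      "direction L = ?class L \<times> ?class L \<union> (S - ?class L) \<times> (S - ?class L)"
      using AB(1,2) assms(2) by auto
  qed
  have "bij_betw ?class ?P {A. i \<in> A \<and> A \<subseteq> S}"
  proof (rule bij_betw_imageI)
    show "inj_on ?class ?P"
    proof (rule inj_onI)
      fix L M assume L: "L \<in> ?P" and M: "M \<in> ?P" and "?class L = ?class M"
      then have "direction L = direction M"
        by (subst direction_eq[OF L], subst direction_eq[OF M]) (simp only:)
      from inj_onD[OF inj_on_direction_pencil this] show "L = M" using L M by blast
    qed
    have "A \<in> ?class ` ?P" if A: "i \<in> A" "A \<subseteq> S" for A
    proof
      have split: "A \<inter> (S - A) = {}" "A \<union> (S - A) \<subseteq> {..<d}" using A(2) assms(1) by auto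
      then show "A = ?class (line_along A (S - A) center)" using A by (auto simp: direction_line_along)
      show "line_along A (S - A) center \<in> ?P"
        using line_along_center[OF split] support_line_along[OF split(2)] A by auto
    qed
    then show "?class ` ?P = {A. i \<in> A \<and> A \<subseteq> S}" using class_bounds by auto
  qed
  then have "card ?P = card {A. i \<in> A \<and> A \<subseteq> S}" by (rule bij_betw_same_card)
  also have "\<dots> = 2 ^ (card S - 1)"
    by (rule card_subsets_containing[OF finite_subset[OF assms(1) finite_lessThan] assms(2)])
  finally show ?thesis .
qed

lemma card_center_lines_less_full:
  assumes "S \<subset> {..<d}"
  shows "card {L \<in> pencil center. support L = S} <
    card {L \<in> pencil center. support L = {..<d}}"
proof -
  have full: "card {L \<in> pencil center. support L = {..<d}} = 2 ^ (d - 1)"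
    using card_center_lines_with_support[of "{..<d}" 0] by simp
  show ?thesis
  proof (cases "S = {}")
    case True
    then have "{L \<in> pencil center. support L = S} = {}"
      using line_support_nonempty by (auto simp: pencil_def)
    then show ?thesis by (simp only: full) simp
  next
    case False
    then obtain i where "i \<in> S" by blast
    moreover have "0 < card S" "card S < d"
      using False finite_subset[of S "{..<d}"] psubset_card_mono[of "{..<d}" S] assms
      by (auto simp: card_gt_0_iff)
    ultimately show ?thesis
      using full card_center_lines_with_support[of S i] assms by auto
  qed
qed

lemma line_perm_diagonal_nth_neq_h:
  assumes T: "T \<in> line_perms n d" and p: "diagonal p" "p \<noteq> center" and "i < d"
  shows "T p ! i \<noteq> h"
proof
  let ?lines = "\<lambda>S. {L \<in> pencil center. support L = S}"
  let ?joined = "\<lambda>p. {L \<in> pencil center. doubly_joined {center} p L}"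
  let ?S = "{i. i < d \<and> T p ! i \<noteq> h}"
  assume "T p ! i = h"
  then have S: "?S \<subset> {..<d}" using \<open>i < d\<close> by blast
  have p_cube: "p \<in> cube n d" using p(1) by (rule diagonal_in_cube)
  have Tp: "T p \<in> cube n d" "T p \<noteq> center"
    using line_perm_in_cube[OF T p_cube] line_perm_eq_center_iff[OF T p_cube] p(2) by auto
  have "card (?lines {..<d}) \<le> card (?joined p)"
    using full_line_doubly_joined[OF p] by (intro card_mono) auto
  also have "\<dots> \<le> card (?joined (T p))"
  proof (rule card_inj_on_le)
    show "inj_on ((`) T) (?joined p)" by (rule inj_on_subset[OF line_perm_inj_on_pencil[OF T]]) auto
    have "T ` L \<in> ?joined (T p)" if L: "L \<in> ?joined p" for L
    proof -
      have "T ` L \<in> pencil center"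
        using L line_perm_line[OF T] line_perm_center[OF T] by (force simp: pencil_def)
      moreover have "doubly_joined {center} (T p) (T ` L)"
        using L line_perm_eq_center_iff[OF T]
        by (intro line_perm_doubly_joined[OF T]) (auto simp: pencil_def)
      ultimately show ?thesis by simp
    qed
    then show "(`) T ` ?joined p \<subseteq> ?joined (T p)" by blast
  qed simp
  also have "\<dots> \<le> card (?lines ?S)"
    using doubly_joined_support[OF Tp] by (intro card_mono) auto
  also have "\<dots> < card (?lines {..<d})" by (rule card_center_lines_less_full[OF S])
  finally show False by simp
qed

lemma line_perm_diagonal_odd:
  assumes T: "T \<in> line_perms n d" and x: "diagonal x"
  shows "diagonal (T x)"
proof (cases "x = center")
  case True
  then show ?thesis using line_perm_center[OF T] x by simp
next
  case False
  obtain i where i: "i < d" "x ! i \<noteq> h"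
    using neq_center_iff[OF diagonal_in_cube[OF x]] False by blast
  obtain L where "L \<in> pencil x" and full: "support L = {..<d}"
    using diagonal_obtain_line[OF x, of "{..<d}"] by (auto simp: lessThan_empty_iff)
  then have L: "is_line n d L" "x \<in> L" by (auto simp: pencil_def)
  obtain z where z: "z \<in> L" "z ! 0 = h" using line_obtain_nth[OF L(1), of 0 h] full by auto
  have "z ! i = h" if "i < d" for i
    using full_line_diagonal[OF L(1) full z(1)] that z(2) d_pos opp_h
    unfolding diagonal_def by metis
  then have "z = center" using neq_center_iff line_in_cube[OF L(1) z(1)] by blast
  then have "T center \<in> T ` L" using z(1) by blast
  moreover have "T center ! i = h" if "i < d" for i using line_perm_center[OF T] that by simp
  ultimately have "i \<in> support (T ` L)" if "i < d" for i
    using supportI[OF that imageI[OF L(2)]] line_perm_diagonal_nth_neq_h[OF T x False that] that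
    by metis
  then have "support (T ` L) = {..<d}" using support_less by blast
  then show ?thesis using full_line_diagonal[OF line_perm_line[OF T L(1)]] L(2) by blast
qed

end

context cube_lines begin

lemma line_perm_diagonal:
  assumes T: "T \<in> line_perms n d" and x: "diagonal x"
  shows "diagonal (T x)"
proof (cases "\<exists>h<n. opp h = h")
  case True
  then obtain h where "h < n" "opp h = h" by blast
  then interpret odd_cube_lines n d h by unfold_locales
  show ?thesis using T x by (rule line_perm_diagonal_odd)
qed (use line_perm_diagonal_even[OF T _ x] in blast)

lemma line_perm_full_line_iff:
  assumes T: "T \<in> line_perms n d" and L: "is_line n d L"
  shows "support (T ` L) = {..<d} \<longleftrightarrow> support L = {..<d}"
proof -
  obtain S where S: "S \<in> line_perms n d" "\<And>x. x \<in> cube n d \<Longrightarrow> S (T x) = x"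
    by (rule line_perm_inverse[OF T]) blast
  have "diagonal (T x) \<longleftrightarrow> diagonal x" if "x \<in> L" for x
    using line_perm_diagonal[OF T] line_perm_diagonal[OF S(1), of "T x"]
      S(2)[OF line_in_cube[OF L that]] by auto
  then show ?thesis unfolding full_line_iff[OF L] full_line_iff[OF line_perm_line[OF T L]] by blast
qed

subsection \<open>Corners\<close>

lemma corners_iff: "x \<in> corners n d \<longleftrightarrow> x \<in> cube n d \<and> (\<forall>i<d. x ! i = 0 \<or> x ! i = opp 0)"
  by (auto simp: corners_def cube_def opp_def set_conv_nth)

lemma corner_in_cube: "x \<in> corners n d \<Longrightarrow> x \<in> cube n d"
  by (simp add: corners_def)

lemma finite_corners: "finite (corners n d)"
  by (rule finite_subset[OF _ finite_cube]) (auto simp: corners_def)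

lemma corner_nth: "x \<in> corners n d \<Longrightarrow> i < d \<Longrightarrow> x ! i = 0 \<or> x ! i = opp 0"
  by (simp add: corners_iff)

lemma corner_update:
  assumes "x \<in> corners n d" "v = 0 \<or> v = opp 0"
  shows "x[i := v] \<in> corners n d"
  using assms set_update_subset_insert[of x i v] n_ge_3 by (auto simp: corners_def cube_def opp_def)

lemma corner_diagonal: "x \<in> corners n d \<Longrightarrow> diagonal x"
  by (auto simp: corners_iff diagonal_def) (metis n_pos opp_opp)+

lemma corners_collinear:
  assumes "x \<in> corners n d" "y \<in> corners n d"
  shows "collinear x y"
proof (rule collinear_if_opposite[OF _ _ n_pos])
  show "(x ! i = 0 \<or> x ! i = opp 0) \<and> y ! i = opp (x ! i)" if "i \<in> differ x y" for i
    using corner_nth[OF assms(1), of i] corner_nth[OF assms(2), of i] that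
    by (auto simp: differ_def)
qed (use assms corner_in_cube in auto)

lemma corner_obtain_line:
  assumes "x \<in> corners n d" "y \<in> corners n d" "x \<noteq> y"
  obtains L where "is_line n d L" "x \<in> L" "y \<in> L" "support L = differ x y"
  using corners_collinear[OF assms(1,2)] line_support_eq_differ assms(3)
  by (auto simp: collinear_def)

lemma line_perm_corner_same_level:
  assumes T: "T \<in> line_perms n d" and x: "x \<in> corners n d" and y: "y \<in> corners n d"
  shows "T y ! 0 = T x ! 0 \<or> T y ! 0 = opp (T x ! 0)"
proof -
  have shared: "T y ! 0 = T x ! 0 \<or> T y ! 0 = opp (T x ! 0)"
    if x: "x \<in> corners n d" and y: "y \<in> corners n d" and i: "i < d" "x ! i = y ! i" for x y i
  proof (cases "x = y")
    case False
    obtain L where L: "is_line n d L" "x \<in> L" "y \<in> L" "support L = differ x y"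
      using corner_obtain_line[OF x y False] .
    then have "support (T ` L) \<noteq> {..<d}"
      using line_perm_full_line_iff[OF T L(1)] i by (auto simp: differ_def)
    then obtain j where j: "j < d" "j \<notin> support (T ` L)" using support_less by blast
    have "T x ! j = T y ! j"
      by (rule nth_eq_if_not_support[OF j imageI[OF L(2)] imageI[OF L(3)]])
    moreover have "T z ! 0 = T z ! j \<or> T z ! 0 = opp (T z ! j)" if "z \<in> corners n d" for z
      using line_perm_diagonal[OF T corner_diagonal[OF that]] j(1) d_pos
      unfolding diagonal_def by blast
    from this[OF x] this[OF y]
    have "T x ! 0 = T x ! j \<or> T x ! 0 = opp (T x ! j)"
      "T y ! 0 = T y ! j \<or> T y ! 0 = opp (T y ! j)" .
    moreover have "T y ! j < n"
      using cube_nth_less[OF line_perm_in_cube[OF T corner_in_cube[OF y]] j(1)] .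
    ultimately show ?thesis by auto
  qed simp
  define z where "z = x[0 := y ! 0]"
  have z: "z \<in> corners n d"
    unfolding z_def using y by (intro corner_update x) (simp add: corners_iff)
  have "length x = d" using x by (simp add: corners_iff cube_iff)
  then have "z ! 0 = y ! 0" "x ! 1 = z ! 1" by (auto simp: z_def)
  then have "T y ! 0 = T z ! 0 \<or> T y ! 0 = opp (T z ! 0)"
    "T z ! 0 = T x ! 0 \<or> T z ! 0 = opp (T x ! 0)"
    using shared[OF z y d_pos] shared[OF x z, of 1] by auto
  moreover have "T x ! 0 < n"
    using cube_nth_less[OF line_perm_in_cube[OF T corner_in_cube[OF x]]] by simp
  ultimately show ?thesis by auto
qed

lemma line_perm_corner_level:
  assumes T: "T \<in> line_perms n d"
  obtains w where "w < n" "opp w \<noteq> w"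
    "\<And>x i. x \<in> corners n d \<Longrightarrow> i < d \<Longrightarrow> T x ! i = w \<or> T x ! i = opp w"
proof -
  define x where "x = replicate d (0::nat)"
  define w where "w = T x ! 0"
  have x: "x \<in> corners n d" by (auto simp: x_def corners_iff cube_iff)
  have w: "w < n"
    unfolding w_def by (intro cube_nth_less[OF line_perm_in_cube[OF T corner_in_cube[OF x]]] d_pos)
  have level: "T y ! i = w \<or> T y ! i = opp w" if y: "y \<in> corners n d" and "i < d" for y i
  proof -
    have "T y ! 0 = w \<or> T y ! 0 = opp w"
      unfolding w_def by (rule line_perm_corner_same_level[OF T x y])
    moreover have "T y ! i = T y ! 0 \<or> T y ! i = opp (T y ! 0)"
      using line_perm_diagonal[OF T corner_diagonal[OF y]] \<open>i < d\<close> d_pos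
      unfolding diagonal_def by blast
    ultimately show ?thesis using w by auto
  qed
  have "opp w \<noteq> w"
  proof
    assume "opp w = w"
    have y: "x[0 := opp 0] \<in> corners n d" by (intro corner_update x) simp
    have "T (x[0 := opp 0]) = T x"
      using level[OF x] level[OF y] \<open>opp w = w\<close> line_perm_in_cube[OF T corner_in_cube] x y
      by (intro cube_eqI) auto
    then have "x[0 := opp 0] = x" using line_perm_eq_iff[OF T] x y corner_in_cube by blast
    then have "x[0 := opp 0] ! 0 = x ! 0" by simp
    then show False by (simp add: x_def)
  qed
  then show ?thesis using that w level by blast
qed

subsection \<open>Adjacency of corners\<close>

lemma line_perm_corner_iff:
  assumes T: "T \<in> line_perms n d" "T ` corners n d \<subseteq> corners n d" and x: "x \<in> cube n d"
  shows "T x \<in> corners n d \<longleftrightarrow> x \<in> corners n d"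
proof
  have inj: "inj_on T (corners n d)"
    by (rule inj_on_subset[OF line_perm_inj_on[OF T(1)]]) (auto simp: corners_def)
  assume "T x \<in> corners n d"
  then obtain y where "y \<in> corners n d" "T x = T y"
    using endo_inj_surj[OF finite_corners T(2) inj] by (metis imageE)
  then show "x \<in> corners n d" using line_perm_eq_iff[OF T(1) x] corner_in_cube by metis
qed (use T(2) in blast)

definition corner_line :: "nat list set \<Rightarrow> bool" where
  "corner_line L \<longleftrightarrow> is_line n d L \<and> (\<exists>x\<in>L \<inter> corners n d. \<exists>y\<in>L \<inter> corners n d. x \<noteq> y)"

text \<open>The alternative \<open>p \<in> M\<close> serves \<open>n = 3\<close>, where a corner line has only one point that is not a
  corner.\<close>

definition crossed :: "nat list set \<Rightarrow> bool" where
  "crossed L \<longleftrightarrow> (\<exists>M. corner_line M \<and> M \<noteq> L \<and>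
     (\<exists>p\<in>L - corners n d. p \<in> M \<or> doubly_joined (corners n d) p M))"

lemma corner_line_is_line: "corner_line L \<Longrightarrow> is_line n d L"
  by (simp add: corner_line_def)

lemma line_perm_corner_line:
  assumes T: "T \<in> line_perms n d" "T ` corners n d \<subseteq> corners n d" and L: "corner_line L"
  shows "corner_line (T ` L)"
proof -
  obtain x y where xy: "is_line n d L" "x \<in> L" "y \<in> L" "x \<in> corners n d" "y \<in> corners n d" "x \<noteq> y"
    using L by (auto simp: corner_line_def)
  then have "T x \<noteq> T y" using line_perm_eq_iff[OF T(1)] corner_in_cube by blast
  then show ?thesis unfolding corner_line_def using line_perm_line[OF T(1)] T(2) xy by blast
qed

lemma line_perm_crossed:
  assumes T: "T \<in> line_perms n d" "T ` corners n d \<subseteq> corners n d"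
    and L: "is_line n d L" "crossed L"
  shows "crossed (T ` L)"
proof -
  obtain M p where M: "corner_line M" "M \<noteq> L" and p: "p \<in> L - corners n d"
    and joined: "p \<in> M \<or> doubly_joined (corners n d) p M"
    using L(2) by (auto simp: crossed_def)
  note M_line = corner_line_is_line[OF M(1)]
  have "corner_line (T ` M)" by (rule line_perm_corner_line[OF T M(1)])
  moreover have "T ` M \<noteq> T ` L"
    using inj_onD[OF line_perm_inj_on_lines[OF T(1)], of M L] M(2) M_line L(1) by blast
  moreover have "T p \<in> T ` L - corners n d"
    using line_perm_corner_iff[OF T line_in_cube[OF L(1)]] p by blast
  moreover have "T p \<in> T ` M \<or> doubly_joined (corners n d) (T p) (T ` M)"
    using joined line_perm_doubly_joined[OF T(1) line_perm_corner_iff[OF T] M_line] by blast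
  ultimately show ?thesis unfolding crossed_def by blast
qed

lemma corner_line_support:
  assumes "corner_line L" and z: "z \<in> L" "z \<notin> corners n d"
  shows "support L = {i. i < d \<and> z ! i \<noteq> 0 \<and> z ! i \<noteq> opp 0}"
proof -
  obtain x y where L: "is_line n d L"
    and xy: "x \<in> L" "y \<in> L" "x \<in> corners n d" "y \<in> corners n d" "x \<noteq> y"
    using assms(1) by (auto simp: corner_line_def)
  have "i \<in> support L \<longleftrightarrow> z ! i \<noteq> 0 \<and> z ! i \<noteq> opp 0" if "i < d" for i
  proof
    assume i: "i \<in> support L"
    have "u = v" if "u \<in> L" "v \<in> L" "u ! i = v ! i" for u v
      using line_eq_if_nth_eq[OF L i that] .
    then have "z ! i \<noteq> x ! i" "z ! i \<noteq> y ! i" "x ! i \<noteq> y ! i" using xy z by blast+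
    then show "z ! i \<noteq> 0 \<and> z ! i \<noteq> opp 0"
      using xy(3,4) \<open>i < d\<close> unfolding corners_iff by metis
  next
    assume "z ! i \<noteq> 0 \<and> z ! i \<noteq> opp 0"
    then have "z ! i \<noteq> x ! i" using xy(3) \<open>i < d\<close> unfolding corners_iff by metis
    then show "i \<in> support L" by (rule supportI[OF \<open>i < d\<close> z(1) xy(1)])
  qed
  then show ?thesis using support_less by blast
qed

lemma line_eqI_singleton_support:
  assumes "is_line n d L" "is_line n d M" "support L = {i}" "support M = {i}" "x \<in> L" "x \<in> M"
  shows "L = M"
  using assms by (intro line_eqI_direction[of L x M]) (auto simp: direction_def)

lemma mem_line_if_differ_singleton:
  assumes L: "is_line n d L" "support L = {i}" and p: "p \<in> L"
    and u: "u \<in> cube n d" "differ u p \<subseteq> {i}"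
  shows "u \<in> L"
proof -
  have "i < d" using L(2) support_less by blast
  obtain z where z: "z \<in> L" "z ! i = u ! i"
    using line_obtain_nth[OF L(1), of i "u ! i"] L(2) cube_nth_less[OF u(1) \<open>i < d\<close>] by blast
  have "u ! j = z ! j" if "j < d" for j
    using nth_eq_if_not_support[OF that _ z(1) p] L(2) u(2) z(2) that
    by (cases "j = i") (auto simp: differ_def)
  then have "u = z" using cube_eqI[OF u(1) line_in_cube[OF L(1) z(1)]] by blast
  then show ?thesis using z(1) by simp
qed

lemma edge_not_crossed:
  assumes L: "corner_line L" "support L = {i}"
  shows "\<not> crossed L"
proof
  assume "crossed L"
  then obtain M p where M: "corner_line M" "M \<noteq> L" and p: "p \<in> L" "p \<notin> corners n d"
    and joined: "p \<in> M \<or> doubly_joined (corners n d) p M"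
    by (auto simp: crossed_def)
  note L_line = corner_line_is_line[OF L(1)] and M_line = corner_line_is_line[OF M(1)]
  have inner: "{j. j < d \<and> p ! j \<noteq> 0 \<and> p ! j \<noteq> opp 0} = {i}"
    using corner_line_support[OF L(1) p] L(2) by simp
  have not_near: "\<not> differ u p \<subseteq> {i}" if u: "u \<in> M" "u \<notin> corners n d" for u
  proof
    assume near: "differ u p \<subseteq> {i}"
    have "support M \<subseteq> {i}"
      using corner_line_support[OF M(1) u] near inner by (fastforce simp: differ_def)
    then have "support M = {i}" using line_support_nonempty[OF M_line] by blast
    moreover have "u \<in> L"
      using mem_line_if_differ_singleton[OF L_line L(2) p(1) line_in_cube[OF M_line u(1)] near] .
    ultimately have "M = L" using line_eqI_singleton_support[OF M_line L_line _ L(2) u(1)] by blast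
    then show False using M(2) by simp
  qed
  have same_nth: "u ! i = p ! i" if u: "u \<in> M" "u \<notin> corners n d" "collinear p u" for u
  proof -
    obtain j where j: "j < d" "u ! j \<noteq> p ! j" "j \<noteq> i"
      using not_near[OF u(1,2)] by (auto simp: differ_def)
    then have "p ! j = 0 \<or> p ! j = opp 0" using inner by blast
    moreover have "i < d" "p ! i \<noteq> 0" "p ! i \<noteq> opp 0" using inner by auto
    ultimately show ?thesis using collinear_nth_eq[OF u(3) \<open>i < d\<close> j(1)] j(2) by auto
  qed
  have "p \<notin> M" using not_near[OF _ p(2)] by (auto simp: differ_def)
  then obtain q q' where q: "q \<in> M" "q' \<in> M" "q \<notin> corners n d" "q' \<notin> corners n d" "q \<noteq> q'"
    "collinear p q" "collinear p q'"
    using joined by (auto simp: doubly_joined_def)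
  then have "q ! i = p ! i" "q' ! i = p ! i" using same_nth by auto
  moreover have "i \<in> {j. j < d \<and> p ! j \<noteq> 0 \<and> p ! j \<noteq> opp 0}" using inner by simp
  then have "i \<in> support M" using corner_line_support[OF M(1) q(1,3)] \<open>q ! i = p ! i\<close> by simp
  ultimately show False using line_eq_if_nth_eq[OF M_line _ q(1,2), of i] q(5) by simp
qed

lemma signed_perm_corners:
  assumes "\<sigma> permutes {..<d}"
  shows "signed_perm \<sigma> S ` corners n d \<subseteq> corners n d"
proof
  fix y assume "y \<in> signed_perm \<sigma> S ` corners n d"
  then obtain x where x: "x \<in> corners n d" "y = signed_perm \<sigma> S x" by blast
  have "y ! i = 0 \<or> y ! i = opp 0" if "i < d" for i
    using corner_nth[OF x(1) permutes_lessThan_less[OF assms that]]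
      signed_perm_nth[OF corner_in_cube[OF x(1)] that] x(2)
    by auto
  then show "y \<in> corners n d"
    using x signed_perm_in_cube[OF assms corner_in_cube] by (simp add: corners_iff)
qed

lemma reflect_nth:
  "x \<in> cube n d \<Longrightarrow> i < d \<Longrightarrow> signed_perm id {j} x ! i = (if i = j then opp (x ! j) else x ! i)"
  by (simp add: signed_perm_nth)

lemma collinear_reflect:
  assumes L: "is_line n d L" "i \<in> support L" "j \<in> support L" and k: "k < n"
    and x: "x \<in> L" "x ! i = k \<or> x ! i = opp k" and y: "y \<in> L" "y ! i = k \<or> y ! i = opp k"
  shows "collinear x (signed_perm id {j} y)"
proof -
  have cube: "x \<in> cube n d" "y \<in> cube n d" using line_in_cube[OF L(1)] x y by auto
  have level: "z ! a = k \<or> z ! a = opp k"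
    if "z \<in> L" "z ! i = k \<or> z ! i = opp k" "a \<in> support L" for z a
    using L(1,2) that(3) by (cases rule: line_nth_cases) (use that k in auto)
  show ?thesis
  proof (rule collinear_if_opposite[OF cube(1) signed_perm_in_cube[OF permutes_id cube(2)] k])
    fix a assume "a \<in> differ x (signed_perm id {j} y)"
    then have a: "a < d" "x ! a \<noteq> (if a = j then opp (y ! j) else y ! a)"
      using reflect_nth[OF cube(2)] by (auto simp: differ_def)
    then have a_supp: "a \<in> support L"
      using nth_eq_if_not_support[OF a(1) _ x(1) y(1)] L(3) by (cases "a = j") auto
    show "(x ! a = k \<or> x ! a = opp k) \<and> signed_perm id {j} y ! a = opp (x ! a)"
      using level[OF x a_supp] level[OF y a_supp] a reflect_nth[OF cube(2) a(1)] k
      by (auto split: if_splits)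
  qed
qed

text \<open>The mirror image of the line in one of its varying coordinates crosses it.\<close>

lemma crossed_if_not_edge:
  assumes L: "corner_line L" and i: "i \<in> support L" and j: "j \<in> support L" and "i \<noteq> j"
  shows "crossed L"
proof -
  define F where "F = signed_perm id {j}"
  note line = corner_line_is_line[OF L]
  have ij: "i < d" "j < d" using i j support_less by auto
  have F: "F \<in> line_perms n d" "F ` corners n d \<subseteq> corners n d"
    using reflect_aut_group[OF ij(2)] aut_group_subset_line_perms
      signed_perm_corners[OF permutes_id] by (auto simp: F_def)
  have F_nth: "F z ! i = z ! i" "F z ! j = opp (z ! j)" if "z \<in> L" for z
    using reflect_nth[OF line_in_cube[OF line that]] ij \<open>i \<noteq> j\<close> by (simp_all add: F_def)
  have "F ` L \<noteq> L"
  proof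
    assume "F ` L = L"
    obtain x where x: "x \<in> L" "x \<in> corners n d" using L by (auto simp: corner_line_def)
    then have "F x = x" using line_eq_if_nth_eq[OF line i _ x(1)] F_nth(1) \<open>F ` L = L\<close> by blast
    then show False using F_nth(2)[OF x(1)] x(2) ij(2) by (auto simp: corners_iff)
  qed
  moreover have "1 \<noteq> opp 0" "opp 1 \<noteq> 0" "opp 1 \<noteq> opp 0" using n_ge_3 by (auto simp: opp_def)
  then have inner: "z \<notin> corners n d" if "z ! i = 1 \<or> z ! i = opp 1" for z
    using that ij(1) by (auto simp: corners_iff)
  obtain p where p: "p \<in> L" "p ! i = 1" using line_obtain_nth[OF line i, of 1] by auto
  obtain q where q: "q \<in> L" "q ! i = opp 1" using line_obtain_nth[OF line i, of "opp 1"] by auto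
  have "p \<in> F ` L \<or> doubly_joined (corners n d) p (F ` L)"
  proof (cases "p = q")
    case True
    then have "F p ! j = p ! j" using F_nth(2)[OF p(1)] p q line_nth_cases[OF line i j] by metis
    then have "F p = p"
      using reflect_nth[OF line_in_cube[OF line p(1)]] line_in_cube[OF line p(1)]
        line_perm_in_cube[OF F(1)] by (intro cube_eqI) (auto simp: F_def)
    then show ?thesis using p(1) by (metis imageI)
  next
    case False
    then have "F p \<noteq> F q" using line_perm_eq_iff[OF F(1)] line_in_cube[OF line] p(1) q(1) by blast
    moreover have "collinear p (F p)" "collinear p (F q)"
      using collinear_reflect[OF line i j one_less_n] p q by (auto simp: F_def)
    moreover have "F p \<notin> corners n d" "F q \<notin> corners n d" using inner F_nth(1) p q by auto
    ultimately show ?thesis unfolding doubly_joined_def using p(1) q(1) by blast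
  qed
  ultimately show ?thesis
    unfolding crossed_def using line_perm_corner_line[OF F L] p(1) inner[of p] p(2) by blast
qed

definition adjacent :: "nat list \<Rightarrow> nat list \<Rightarrow> bool" where
  "adjacent x y \<longleftrightarrow> is_singleton (differ x y)"

lemma line_perm_adjacent:
  assumes T: "T \<in> line_perms n d" "T ` corners n d \<subseteq> corners n d"
    and x: "x \<in> corners n d" and y: "y \<in> corners n d" and "adjacent x y"
  shows "adjacent (T x) (T y)"
proof -
  have cube: "x \<in> cube n d" "y \<in> cube n d" using x y corner_in_cube by auto
  obtain i where i: "differ x y = {i}"
    using \<open>adjacent x y\<close> by (auto simp: adjacent_def is_singleton_def)
  then have "x \<noteq> y" by (auto simp: differ_def)
  then obtain L where L: "is_line n d L" "x \<in> L" "y \<in> L" "support L = {i}"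
    using corner_obtain_line[OF x y] i by metis
  then have "corner_line L" using x y \<open>x \<noteq> y\<close> by (auto simp: corner_line_def)
  then have TL: "is_line n d (T ` L)" "corner_line (T ` L)"
    using line_perm_corner_line[OF T] corner_line_is_line by auto
  obtain S where S: "S \<in> line_perms n d" "\<And>x. x \<in> cube n d \<Longrightarrow> S (T x) = x"
    "\<And>x. x \<in> cube n d \<Longrightarrow> T (S x) = x"
    by (rule line_perm_inverse[OF T(1)]) blast
  have "S ` corners n d \<subseteq> corners n d"
    using line_perm_corner_iff[OF T line_perm_in_cube[OF S(1)]] S(3) corner_in_cube by auto
  then have "crossed (S ` T ` L)" if "crossed (T ` L)"
    using line_perm_crossed[OF S(1) _ TL(1) that] by blast
  moreover have "S ` T ` L = L"
    using S(2) line_in_cube[OF L(1)] by (simp add: image_image)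
  ultimately have "\<not> crossed (T ` L)"
    using edge_not_crossed[OF \<open>corner_line L\<close> L(4)] by auto
  then have "is_singleton (support (T ` L))"
    using crossed_if_not_edge[OF TL(2)] line_support_nonempty[OF TL(1)]
    by (metis is_singletonI')
  moreover have "T x \<noteq> T y" using line_perm_eq_iff[OF T(1) cube] \<open>x \<noteq> y\<close> by simp
  ultimately show ?thesis
    unfolding adjacent_def using line_support_eq_differ[OF TL(1), of "T x" "T y"] L(2,3) by simp
qed

subsection \<open>Normalisation by automorphisms\<close>

definition aut_orbit :: "(nat list \<Rightarrow> nat list) \<Rightarrow> (nat list \<Rightarrow> nat list) set" where
  "aut_orbit T = {compose (cube n d) A T | A. A \<in> aut_group n d}"

lemma aut_orbit_line_perm: "T \<in> line_perms n d \<Longrightarrow> T' \<in> aut_orbit T \<Longrightarrow> T' \<in> line_perms n d"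
  using compose_line_perm aut_group_subset_line_perms by (auto simp: aut_orbit_def)

lemma aut_orbit_trans:
  assumes "T \<in> line_perms n d" "T' \<in> aut_orbit T" "T'' \<in> aut_orbit T'"
  shows "T'' \<in> aut_orbit T"
proof -
  obtain A B where A: "A \<in> aut_group n d" "T' = compose (cube n d) A T"
    and B: "B \<in> aut_group n d" "T'' = compose (cube n d) B T'"
    using assms(2,3) by (auto simp: aut_orbit_def)
  have "T'' = compose (cube n d) (compose (cube n d) B A) T"
    unfolding A(2) B(2) using line_perm_in_cube[OF assms(1)] by (intro compose_assoc) auto
  then show ?thesis using compose_aut_group[OF B(1) A(1)] by (auto simp: aut_orbit_def)
qed

lemma ex_level_permutation:
  assumes w: "w < n" "opp w \<noteq> w"
  obtains \<pi> where "\<pi> permutes {..<n}" "\<And>k. k < n \<Longrightarrow> \<pi> (opp k) = opp (\<pi> k)"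
    "\<pi> w = 0 \<or> \<pi> w = opp 0"
proof (cases "w = 0 \<or> w = opp 0")
  case True
  then show ?thesis using that[of id] permutes_id by auto
next
  case False
  define \<pi> where "\<pi> = transpose 0 w \<circ> transpose (opp 0) (opp w)"
  have distinct: "opp w \<noteq> 0" "opp w \<noteq> opp 0"
    using False w opp_eq_iff[of w 0] opp_inject[of w 0] by auto
  have \<pi>: "\<pi> k = (if k = 0 then w else if k = w then 0 else if k = opp 0 then opp w
      else if k = opp w then opp 0 else k)" for k
    using False distinct w(2) by (auto simp: \<pi>_def transpose_def)
  have "\<pi> permutes {..<n}"
    unfolding \<pi>_def using w(1) by (intro permutes_compose permutes_swap_id) auto
  moreover have "\<pi> (opp k) = opp (\<pi> k)" if k: "k < n" for k
  proof -
    have "opp k = 0 \<longleftrightarrow> k = opp 0" "opp k = opp 0 \<longleftrightarrow> k = 0"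
      "opp k = w \<longleftrightarrow> k = opp w" "opp k = opp w \<longleftrightarrow> k = w"
      using k w(1) opp_eq_iff opp_inject by auto
    then show ?thesis using False distinct w by (simp add: \<pi>)
  qed
  moreover have "\<pi> w = 0" using False by (simp add: \<pi>)
  ultimately show ?thesis using that by blast
qed

lemma ex_aut_orbit_corners:
  assumes T: "T \<in> line_perms n d"
  shows "\<exists>T'\<in>aut_orbit T. T' ` corners n d \<subseteq> corners n d"
proof -
  obtain w where w: "w < n" "opp w \<noteq> w"
    and level: "\<And>x i. x \<in> corners n d \<Longrightarrow> i < d \<Longrightarrow> T x ! i = w \<or> T x ! i = opp w"
    using line_perm_corner_level[OF T] by blast
  obtain \<pi> where \<pi>: "\<pi> permutes {..<n}" "\<And>k. k < n \<Longrightarrow> \<pi> (opp k) = opp (\<pi> k)"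
    "\<pi> w = 0 \<or> \<pi> w = opp 0"
    using ex_level_permutation[OF w] by blast
  let ?A = "coord_map n d \<pi>"
  have A: "?A \<in> aut_group n d"
    using \<pi> coord_group_iff coord_group_subset_aut_group by blast
  have "?A (T x) \<in> corners n d" if x: "x \<in> corners n d" for x
  proof -
    have Tx: "T x \<in> cube n d" using line_perm_in_cube[OF T corner_in_cube[OF x]] .
    have "?A (T x) ! i = 0 \<or> ?A (T x) ! i = opp 0" if "i < d" for i
      using level[OF x that] \<pi>(3) \<pi>(2)[OF w(1)] coord_map_nth[OF Tx that] by auto
    then show ?thesis using Bij_in_cube[OF aut_group_Bij[OF A] Tx] by (simp add: corners_iff)
  qed
  then have "compose (cube n d) ?A T ` corners n d \<subseteq> corners n d"
    using corner_in_cube by (auto simp: compose_eq)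
  then show ?thesis using A by (auto simp: aut_orbit_def)
qed

abbreviation origin :: "nat list" where "origin \<equiv> replicate d 0"

definition axis_corner :: "nat \<Rightarrow> nat list" where "axis_corner i = origin[i := opp 0]"

lemma origin_corner [simp]: "origin \<in> corners n d"
  by (simp add: corners_iff cube_iff)

lemma axis_corner_corner [simp]: "axis_corner i \<in> corners n d"
  unfolding axis_corner_def by (intro corner_update origin_corner) simp

lemmas origin_in_cube [simp] = corner_in_cube[OF origin_corner]
  and axis_corner_in_cube [simp] = corner_in_cube[OF axis_corner_corner]

lemma nth_axis_corner [simp]: "j < d \<Longrightarrow> axis_corner i ! j = (if j = i then opp 0 else 0)"
  by (simp add: axis_corner_def)

lemma axis_corner_inject: "i < d \<Longrightarrow> axis_corner i = axis_corner j \<Longrightarrow> i = j"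
  using nth_axis_corner[of i i] nth_axis_corner[of i j] by (auto split: if_splits)

lemma adjacent_origin_iff:
  assumes "x \<in> corners n d"
  shows "adjacent origin x \<longleftrightarrow> (\<exists>i<d. x = axis_corner i)"
proof
  assume "adjacent origin x"
  then obtain i where i: "differ origin x = {i}" by (auto simp: adjacent_def is_singleton_def)
  have nth_0: "x ! j = 0 \<longleftrightarrow> j \<noteq> i" if "j < d" for j
  proof -
    have "j \<in> differ origin x \<longleftrightarrow> j = i" by (simp add: i)
    then show ?thesis using that by (auto simp: differ_def)
  qed
  have "x = axis_corner i"
    using nth_0 corner_nth[OF assms]
    by (intro cube_eqI[OF corner_in_cube[OF assms] axis_corner_in_cube]) auto
  moreover have "i < d" using i by (auto simp: differ_def)
  ultimately show "\<exists>i<d. x = axis_corner i" by blast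
next
  assume "\<exists>i<d. x = axis_corner i"
  then obtain i where "i < d" "x = axis_corner i" by blast
  then have "differ origin x = {i}" by (auto simp: differ_def split: if_splits)
  then show "adjacent origin x" by (simp add: adjacent_def)
qed

lemma ex_aut_orbit_origin:
  assumes T: "T \<in> line_perms n d" "T ` corners n d \<subseteq> corners n d"
  shows "\<exists>T'\<in>aut_orbit T. T' ` corners n d \<subseteq> corners n d \<and> T' origin = origin"
proof -
  define S where "S = {i. i < d \<and> T origin ! i \<noteq> 0}"
  let ?A = "signed_perm id S"
  have A: "?A \<in> aut_group n d" by (rule reflections_aut_group) (auto simp: S_def)
  have TO: "T origin \<in> corners n d" using T(2) by auto
  have "?A (T origin) = origin"
  proof (rule cube_eqI)
    show "?A (T origin) \<in> cube n d"
      by (rule signed_perm_in_cube[OF permutes_id corner_in_cube[OF TO]])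
    show "?A (T origin) ! i = origin ! i" if "i < d" for i
      using corner_nth[OF TO that] signed_perm_nth[OF corner_in_cube[OF TO] that] that
      by (auto simp: S_def)
  qed simp
  moreover have "compose (cube n d) ?A T ` corners n d \<subseteq> corners n d"
    using signed_perm_corners[OF permutes_id, of S] T(2) corner_in_cube by (auto simp: compose_eq)
  ultimately show ?thesis
    unfolding aut_orbit_def using A by (auto simp: compose_eq)
qed

lemma line_perm_axis_corners:
  assumes T: "T \<in> line_perms n d" "T ` corners n d \<subseteq> corners n d" "T origin = origin"
  obtains \<sigma> where "\<sigma> permutes {..<d}" "\<And>i. i < d \<Longrightarrow> T (axis_corner i) = axis_corner (\<sigma> i)"
proof -
  have "\<exists>j<d. T (axis_corner i) = axis_corner j" if "i < d" for i
  proof -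
    have "adjacent origin (axis_corner i)" using adjacent_origin_iff that by auto
    then have "adjacent origin (T (axis_corner i))"
      using line_perm_adjacent[OF T(1,2) origin_corner axis_corner_corner] T(3) by simp
    moreover have "T (axis_corner i) \<in> corners n d" using T(2) axis_corner_corner by blast
    ultimately show ?thesis using adjacent_origin_iff by blast
  qed
  then obtain \<tau> where \<tau>: "\<tau> i < d" "T (axis_corner i) = axis_corner (\<tau> i)" if "i < d" for i by metis
  define \<sigma> where "\<sigma> i = (if i < d then \<tau> i else i)" for i
  have "inj_on \<sigma> {..<d}"
  proof (rule inj_onI)
    fix i j assume ij: "i \<in> {..<d}" "j \<in> {..<d}" "\<sigma> i = \<sigma> j"
    then have "T (axis_corner i) = T (axis_corner j)" using \<tau> by (simp add: \<sigma>_def)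
    then show "i = j" using line_perm_eq_iff[OF T(1)] axis_corner_inject ij(1) by simp
  qed
  then have "\<sigma> permutes {..<d}" by (rule inj_imp_permutes) (auto simp: \<sigma>_def \<tau>(1))
  then show ?thesis using that \<tau>(2) by (simp add: \<sigma>_def)
qed

lemma ex_aut_orbit_axis_corners:
  assumes T: "T \<in> line_perms n d" "T ` corners n d \<subseteq> corners n d" "T origin = origin"
  shows "\<exists>T'\<in>aut_orbit T. T' ` corners n d \<subseteq> corners n d \<and> T' origin = origin \<and>
    (\<forall>i<d. T' (axis_corner i) = axis_corner i)"
proof -
  obtain \<sigma> where \<sigma>: "\<sigma> permutes {..<d}"
    and T_axis: "\<And>i. i < d \<Longrightarrow> T (axis_corner i) = axis_corner (\<sigma> i)"
    using line_perm_axis_corners[OF T] by blast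
  let ?A = "signed_perm \<sigma> {}"
  note \<sigma>_less = permutes_lessThan_less[OF \<sigma>]
  have "?A origin = origin"
    using \<sigma>_less signed_perm_in_cube[OF \<sigma>]
    by (intro cube_eqI[of _ n d]) (auto simp: signed_perm_nth)
  moreover have "?A (axis_corner (\<sigma> i)) = axis_corner i" for i
    using \<sigma>_less signed_perm_in_cube[OF \<sigma>] inj_eq[OF permutes_inj[OF \<sigma>]]
    by (intro cube_eqI[of _ n d]) (auto simp: signed_perm_nth)
  moreover have "compose (cube n d) ?A T ` corners n d \<subseteq> corners n d"
    using signed_perm_corners[OF \<sigma>, of "{}"] T(2) corner_in_cube by (auto simp: compose_eq)
  ultimately show ?thesis
    unfolding aut_orbit_def using permute_aut_group[OF \<sigma>] T(3) T_axis by (auto simp: compose_eq)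
qed

lemma adjacent_two_updates:
  assumes x: "x \<in> cube n d" and y: "y \<in> cube n d" and ij: "i < d" "j < d" "i \<noteq> j"
    and "x ! i \<noteq> u" "x ! j \<noteq> v" and adj: "adjacent y (x[i := u])" "adjacent y (x[j := v])"
  shows "y = x \<or> y = x[i := u, j := v]"
proof -
  obtain a b where ab: "differ y (x[i := u]) = {a}" "differ y (x[j := v]) = {b}"
    using adj by (auto simp: adjacent_def is_singleton_def)
  have len: "length x = d" "length y = d" using x y by (auto simp: cube_iff)
  have y_nth: "c \<noteq> a \<Longrightarrow> y ! c = x[i := u] ! c" "c \<noteq> b \<Longrightarrow> y ! c = x[j := v] ! c" if "c < d" for c
    using ab that by (auto simp: differ_def)
  have "a = i \<or> b = i" using y_nth[OF ij(1)] assms(6) ij len by (cases "a = i") auto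
  moreover have "a = j \<or> b = j" using y_nth[OF ij(2)] assms(7) ij len by (cases "a = j") auto
  ultimately consider (straight) "a = i" "b = j" | (crosswise) "a = j" "b = i" using ij(3) by blast
  then show ?thesis
  proof cases
    case straight
    have "y ! c = x ! c" if "c < d" for c
      using y_nth[OF that] straight ij(3) that len by (cases "c = i") auto
    then show ?thesis using len by (auto intro: nth_equalityI)
  next
    case crosswise
    have "y ! c = x[i := u, j := v] ! c" if "c < d" for c
      using y_nth[OF that] crosswise ij(3) that len by (cases "c = j") auto
    then show ?thesis using len by (auto intro!: disjI2 nth_equalityI)
  qed
qed

lemma adjacent_update:
  assumes "x \<in> cube n d" "a < d" "x ! a \<noteq> v"
  shows "adjacent x (x[a := v])"
proof -
  have "differ x (x[a := v]) = {a}"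
    using assms by (auto simp: differ_def cube_iff nth_list_update)
  then show ?thesis by (simp add: adjacent_def)
qed

lemma differ_origin_update: "x \<in> cube n d \<Longrightarrow> differ origin (x[a := 0]) = differ origin x - {a}"
  by (cases "a < d") (auto simp: differ_def cube_iff nth_list_update)

lemma corner_map_eq_id:
  assumes f: "f ` corners n d \<subseteq> corners n d" "inj_on f (corners n d)"
    and f_adj: "\<And>x y. x \<in> corners n d \<Longrightarrow> y \<in> corners n d \<Longrightarrow> adjacent x y \<Longrightarrow> adjacent (f x) (f y)"
    and f_origin: "f origin = origin" and f_axis: "\<And>i. i < d \<Longrightarrow> f (axis_corner i) = axis_corner i"
    and x: "x \<in> corners n d"
  shows "f x = x"
  using x
proof (induction "card (differ origin x)" arbitrary: x rule: less_induct)
  case less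
  note x = less.prems
  have x_cube: "x \<in> cube n d" using x by (rule corner_in_cube)
  have fewer: "f y = y" if "y \<in> corners n d" "differ origin y \<subset> differ origin x" for y
    using less.hyps[OF psubset_card_mono[OF finite_differ that(2)] that(1)] .
  have lowered: "x[a := 0] \<in> corners n d" "f (x[a := 0]) = x[a := 0]" if "a \<in> differ origin x" for a
  proof -
    show corner: "x[a := 0] \<in> corners n d" using x by (intro corner_update) simp_all
    show "f (x[a := 0]) = x[a := 0]"
      using differ_origin_update[OF x_cube, of a] that by (intro fewer[OF corner]) blast
  qed
  consider (origin) "differ origin x = {}" | (axis) "is_singleton (differ origin x)"
    | (higher) i j where "i \<in> differ origin x" "j \<in> differ origin x" "i \<noteq> j"
    by (meson is_singletonI')
  then show ?case
  proof cases
    case origin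
    then show ?thesis using f_origin differ_empty_iff[OF _ x_cube] by simp
  next
    case axis
    then show ?thesis using adjacent_origin_iff[OF x] f_axis by (auto simp: adjacent_def)
  next
    case (higher i j)
    then have ij: "i < d" "j < d" "x ! i \<noteq> 0" "x ! j \<noteq> 0" by (auto simp: differ_def)
    let ?z = "x[i := 0, j := 0]"
    have z: "?z \<in> corners n d" using x by (intro corner_update) simp_all
    have "differ origin ?z \<subset> differ origin x"
      using differ_origin_update[OF corner_in_cube[OF lowered(1)[OF higher(1)]], of j]
        differ_origin_update[OF x_cube, of i] higher(1) by blast
    then have "f ?z = ?z" "?z \<noteq> x" using fewer[OF z] by auto
    then have "f x \<noteq> ?z" using inj_onD[OF f(2) _ x z] by metis
    moreover have "adjacent (f x) (x[i := 0])" "adjacent (f x) (x[j := 0])"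
      using f_adj[OF x lowered(1) adjacent_update[OF x_cube]] lowered(2) higher ij by metis+
    moreover have "f x \<in> cube n d" using f(1) x corner_in_cube by blast
    ultimately show ?thesis
      using adjacent_two_updates[OF x_cube _ ij(1,2) higher(3) ij(3,4)] by blast
  qed
qed

lemma ex_aut_orbit_fixes_corners:
  assumes T: "T \<in> line_perms n d"
  shows "\<exists>T'\<in>aut_orbit T. \<forall>x\<in>corners n d. T' x = x"
proof -
  obtain T\<^sub>1 where T\<^sub>1: "T\<^sub>1 \<in> aut_orbit T" "T\<^sub>1 ` corners n d \<subseteq> corners n d"
    using ex_aut_orbit_corners[OF T] by blast
  note T\<^sub>1_perm = aut_orbit_line_perm[OF T T\<^sub>1(1)]
  obtain T\<^sub>2 where T\<^sub>2: "T\<^sub>2 \<in> aut_orbit T\<^sub>1"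
    "T\<^sub>2 ` corners n d \<subseteq> corners n d" "T\<^sub>2 origin = origin"
    using ex_aut_orbit_origin[OF T\<^sub>1_perm T\<^sub>1(2)] by blast
  note T\<^sub>2_perm = aut_orbit_line_perm[OF T\<^sub>1_perm T\<^sub>2(1)]
  obtain T\<^sub>3 where T\<^sub>3: "T\<^sub>3 \<in> aut_orbit T\<^sub>2"
    "T\<^sub>3 ` corners n d \<subseteq> corners n d" "T\<^sub>3 origin = origin"
    "\<And>i. i < d \<Longrightarrow> T\<^sub>3 (axis_corner i) = axis_corner i"
    using ex_aut_orbit_axis_corners[OF T\<^sub>2_perm T\<^sub>2(2,3)] by blast
  note T\<^sub>3_perm = aut_orbit_line_perm[OF T\<^sub>2_perm T\<^sub>3(1)]
  have "inj_on T\<^sub>3 (corners n d)"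
    by (rule inj_on_subset[OF line_perm_inj_on[OF T\<^sub>3_perm]]) (auto simp: corner_in_cube)
  then have "T\<^sub>3 x = x" if "x \<in> corners n d" for x
    using corner_map_eq_id[OF T\<^sub>3(2) _ line_perm_adjacent[OF T\<^sub>3_perm T\<^sub>3(2)] T\<^sub>3(3,4) that]
    by blast
  then show ?thesis
    using aut_orbit_trans[OF T T\<^sub>1(1)] aut_orbit_trans[OF T\<^sub>1_perm T\<^sub>2(1) T\<^sub>3(1)] by blast
qed

subsection \<open>The first axis\<close>

lemma first_axis_eq: "first_axis n d = line_along {0} {} origin"
proof -
  have "i # replicate (d - 1) 0 = walk {0} {} origin i" for i
    by (intro nth_equalityI) (auto simp: nth_Cons' walk_def)
  then show ?thesis by (auto simp: first_axis_def line_along_def)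
qed

lemma walk_corner_iff:
  assumes "x \<in> corners n d" "A \<union> B \<subseteq> {..<d}" "A \<union> B \<noteq> {}" "k < n"
  shows "walk A B x k \<in> corners n d \<longleftrightarrow> k = 0 \<or> k = opp 0"
proof
  assume w: "walk A B x k \<in> corners n d"
  obtain i where "i \<in> A \<union> B" "i < d" using assms(2,3) by blast
  then show "k = 0 \<or> k = opp 0"
    using corner_nth[OF w, of i] opp_eq_iff[of k 0] opp_inject[of k 0] assms(4)
    by (auto split: if_splits)
next
  assume "k = 0 \<or> k = opp 0"
  then show "walk A B x k \<in> corners n d"
    using walk_in_cube[OF corner_in_cube[OF assms(1)] assms(4)] corner_nth[OF assms(1)]
    by (auto simp: corners_iff)
qed

lemma line_perm_walk:
  assumes T: "T \<in> line_perms n d" "\<And>x. x \<in> corners n d \<Longrightarrow> T x = x" and x: "x \<in> corners n d"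
    and AB: "A \<inter> B = {}" "A \<union> B \<subseteq> {..<d}" "A \<union> B \<noteq> {}" and "k < n"
  obtains l where "l < n" "T (walk A B x k) = walk A B x l" "l = 0 \<or> l = opp 0 \<longleftrightarrow> k = 0 \<or> k = opp 0"
proof -
  let ?L = "line_along A B x" and ?p = "walk A B x 0" and ?q = "walk A B x (opp 0)"
  have L: "is_line n d ?L" by (rule is_line_line_along[OF AB corner_in_cube[OF x]])
  have pq: "?p \<in> ?L" "?q \<in> ?L" by (auto simp: line_along_def)
  obtain i where "i \<in> A \<union> B" "i < d" using AB(2,3) by blast
  then have "?p ! i \<noteq> ?q ! i" by auto
  then have "?p \<noteq> ?q" by metis
  moreover have "T ?p = ?p" "T ?q = ?q" using T(2) walk_corner_iff[OF x AB(2,3)] by auto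
  then have "?p \<in> T ` ?L" "?q \<in> T ` ?L" using pq by (metis imageI)+
  ultimately have "T ` ?L = ?L" using line_unique[OF line_perm_line[OF T(1) L] L] pq by blast
  then have "T (walk A B x k) \<in> ?L" using \<open>k < n\<close> by (auto simp: line_along_def)
  then obtain l where l: "l < n" "T (walk A B x k) = walk A B x l" by (auto simp: line_along_def)
  have "T (walk A B x k) \<in> corners n d \<longleftrightarrow> walk A B x k \<in> corners n d"
    using T by (intro line_perm_corner_iff walk_in_cube corner_in_cube[OF x] \<open>k < n\<close>) auto
  then show ?thesis using that l walk_corner_iff[OF x AB(2,3)] \<open>k < n\<close> by simp
qed

lemma line_perm_plane_walk:
  assumes T: "T \<in> line_perms n d" "\<And>x. x \<in> corners n d \<Longrightarrow> T x = x"
    and ij: "i < d" "j < d" "i \<noteq> j" and AB: "A = {i, j} \<and> B = {} \<or> A = {i} \<and> B = {j}"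
    and k: "k < n" and m: "m < n" "T (walk {i} {} origin k) = walk {i} {} origin m"
  shows "T (walk A B origin k) = walk A B origin m"
proof -
  have AB': "A \<inter> B = {}" "A \<union> B \<subseteq> {..<d}" "A \<union> B \<noteq> {}" using AB ij by auto
  have corner_iff: "walk {i} {} origin l \<in> corners n d \<longleftrightarrow> l = 0 \<or> l = opp 0" if "l < n" for l
    using that ij by (intro walk_corner_iff) auto
  show ?thesis
  proof (cases "k = 0 \<or> k = opp 0")
    case True
    then have "walk {i} {} origin k = walk {i} {} origin m"
      using corner_iff[OF k] T(2) m(2) by metis
    then have "k = m" using nth_walk[OF ij(1), of "{i}" "{}" origin] by (metis insertI1)
    then show ?thesis using True T(2) walk_corner_iff[OF origin_corner AB'(2,3) k] by blast
  next
    case False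
    obtain l where l: "l < n" "T (walk A B origin k) = walk A B origin l"
      "l = 0 \<or> l = opp 0 \<longleftrightarrow> k = 0 \<or> k = opp 0"
      using line_perm_walk[OF T origin_corner AB' k] .
    have "walk {i} {} origin m \<notin> corners n d"
      using line_perm_corner_iff[OF T(1), of "walk {i} {} origin k"] T(2) m(2) False
        corner_iff[OF k] walk_in_cube[OF origin_in_cube k] by auto
    then have m_inner: "m \<noteq> 0" "m \<noteq> opp 0" using corner_iff[OF m(1)] by auto
    have l_inner: "l \<noteq> 0" "opp l \<noteq> 0" using l False opp_eq_iff[of l 0] by auto
    have "differ (walk {i} {} origin k) (walk A B origin k) \<subseteq> {j}"
      using AB by (auto simp: differ_def split: if_splits)
    then have "collinear (walk {i} {} origin k) (walk A B origin k)"
      by (intro collinear_if_differ_singleton walk_in_cube origin_in_cube k)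
    then have "collinear (walk {i} {} origin m) (walk A B origin l)"
      using line_perm_collinear[OF T(1)] m(2) l(2) by metis
    then have "walk {i} {} origin m ! i = walk A B origin l ! i"
      by (rule collinear_nth_eq[OF _ ij(1,2)]) (use AB ij m_inner l_inner in auto)
    then have "m = l" using AB ij by auto
    then show ?thesis using l(2) by simp
  qed
qed

lemma line_perm_other_axis:
  assumes T: "T \<in> line_perms n d" "\<And>x. x \<in> corners n d \<Longrightarrow> T x = x"
    and ij: "i < d" "j < d" "i \<noteq> j" and k: "k < n"
    and m: "m < n" "T (walk {i} {} origin k) = walk {i} {} origin m"
  shows "T (walk {j} {} origin k) = walk {j} {} origin m"
proof -
  obtain l where l: "l < n" "T (walk {j} {} origin k) = walk {j} {} origin l"
    using line_perm_walk[OF T origin_corner, of "{j}" "{}" k] ij k by auto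
  have "T (walk {i, j} {} origin k) = walk {i, j} {} origin m"
    by (rule line_perm_plane_walk[OF T ij _ k m]) auto
  moreover have "T (walk {i, j} {} origin k) = walk {i, j} {} origin l"
    by (rule line_perm_plane_walk[OF T ij(2,1) ij(3)[symmetric] _ k l]) auto
  ultimately have "walk {i, j} {} origin m ! i = walk {i, j} {} origin l ! i" by simp
  then show ?thesis using l(2) ij(1) by simp
qed

lemma line_perm_axis_permutation:
  assumes T: "T \<in> line_perms n d" "\<And>x. x \<in> corners n d \<Longrightarrow> T x = x"
  obtains \<psi> where "\<psi> permutes {..<n}" "\<And>k. k < n \<Longrightarrow> \<psi> (opp k) = opp (\<psi> k)"
    "\<And>k. k < n \<Longrightarrow> T (walk {0} {} origin k) = walk {0} {} origin (\<psi> k)" "\<psi> 0 = 0"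
proof -
  have axis: "\<exists>m<n. T (walk {0} {} origin k) = walk {0} {} origin m" if "k < n" for k
    using line_perm_walk[OF T origin_corner, of "{0}" "{}" k] that by auto
  define \<psi> where "\<psi> k = (if k < n then T (walk {0} {} origin k) ! 0 else k)" for k
  have \<psi>: "\<psi> k < n" "T (walk {0} {} origin k) = walk {0} {} origin (\<psi> k)" if "k < n" for k
    using axis[OF that] that by (auto simp: \<psi>_def)
  have "\<psi> (opp k) = opp (\<psi> k)" if k: "k < n" for k
  proof -
    have "T (walk {0} {1} origin k) = walk {0} {1} origin (\<psi> k)"
      by (rule line_perm_plane_walk[OF T _ _ _ _ k \<psi>[OF k]]) auto
    moreover have second_axis: "T (walk {1} {} origin (opp k)) = walk {1} {} origin (\<psi> (opp k))"
      by (rule line_perm_other_axis[OF T _ _ _ opp_less \<psi>[OF opp_less]]) auto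
    have "T (walk {1} {0} origin (opp k)) = walk {1} {0} origin (\<psi> (opp k))"
      by (rule line_perm_plane_walk[OF T _ _ _ _ opp_less \<psi>(1)[OF opp_less] second_axis]) auto
    moreover have "walk {1} {0} origin (opp k) = walk {0} {1} origin k"
      using k by (simp add: walk_def)
    ultimately have "walk {0} {1} origin (\<psi> k) ! 1 = walk {1} {0} origin (\<psi> (opp k)) ! 1" by simp
    then show ?thesis by simp
  qed
  moreover have "inj_on \<psi> {..<n}"
  proof (rule inj_onI)
    fix k l assume kl: "k \<in> {..<n}" "l \<in> {..<n}" "\<psi> k = \<psi> l"
    then have "T (walk {0} {} origin k) = T (walk {0} {} origin l)" using \<psi>(2) by simp
    then have "walk {0} {} origin k = walk {0} {} origin l"
      using line_perm_eq_iff[OF T(1)] walk_in_cube kl(1,2) by simp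
    then show "k = l" using nth_walk[OF d_pos, of "{0}" "{}" origin] by (metis insertI1)
  qed
  then have "\<psi> permutes {..<n}" by (rule inj_imp_permutes) (use \<psi>(1) in \<open>auto simp: \<psi>_def\<close>)
  moreover have "walk {0} {} origin 0 \<in> corners n d" by (subst walk_corner_iff) auto
  then have "\<psi> 0 = 0" using T(2) by (simp add: \<psi>_def)
  ultimately show ?thesis using that \<psi>(2) by blast
qed

lemma ex_aut_orbit_fixes_first_axis:
  assumes T: "T \<in> line_perms n d" "\<And>x. x \<in> corners n d \<Longrightarrow> T x = x"
  shows "\<exists>T'\<in>aut_orbit T. (\<forall>x\<in>corners n d. T' x = x) \<and> (\<forall>x\<in>first_axis n d. T' x = x)"
proof -
  obtain \<psi> where \<psi>: "\<psi> permutes {..<n}" "\<And>k. k < n \<Longrightarrow> \<psi> (opp k) = opp (\<psi> k)"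
    "\<And>k. k < n \<Longrightarrow> T (walk {0} {} origin k) = walk {0} {} origin (\<psi> k)" "\<psi> 0 = 0"
    using line_perm_axis_permutation[OF T] by blast
  let ?\<rho> = "inv_into UNIV \<psi>" and ?A = "coord_map n d (inv_into UNIV \<psi>)"
  have \<rho>: "?\<rho> permutes {..<n}" by (rule permutes_inv[OF \<psi>(1)])
  have inverse: "?\<rho> (\<psi> k) = k" "\<psi> (?\<rho> k) = k" for k using permutes_inverses[OF \<psi>(1)] by auto
  have \<rho>_opp: "?\<rho> (opp k) = opp (?\<rho> k)" if "k < n" for k
    using \<psi>(2)[OF permutes_lessThan_less[OF \<rho> that]] inverse by metis
  have \<rho>_0: "?\<rho> 0 = 0" "?\<rho> (opp 0) = opp 0" using inverse(1)[of 0] \<psi>(4) \<rho>_opp[of 0] by simp_all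
  have A: "?A \<in> aut_group n d"
    using \<rho> \<rho>_opp coord_group_iff coord_group_subset_aut_group by blast
  have A_cube: "?A x \<in> cube n d" if "x \<in> cube n d" for x
    using Bij_in_cube[OF aut_group_Bij[OF A] that] .
  have "?A x = x" if x: "x \<in> corners n d" for x
  proof (rule cube_eqI[OF A_cube[OF corner_in_cube[OF x]] corner_in_cube[OF x]])
    show "?A x ! i = x ! i" if "i < d" for i
      using corner_nth[OF x that] \<rho>_0 coord_map_nth[OF corner_in_cube[OF x] that] by auto
  qed
  then have "compose (cube n d) ?A T x = x" if "x \<in> corners n d" for x
    using that T(2) corner_in_cube by (simp add: compose_eq)
  moreover have "compose (cube n d) ?A T x = x" if x: "x \<in> first_axis n d" for x
  proof -
    obtain k where k: "k < n" "x = walk {0} {} origin k"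
      using x by (auto simp: first_axis_eq line_along_def)
    have \<psi>k: "walk {0} {} origin (\<psi> k) \<in> cube n d"
      by (intro walk_in_cube origin_in_cube permutes_lessThan_less[OF \<psi>(1) k(1)])
    have x_cube: "x \<in> cube n d" using k by (simp add: walk_in_cube)
    have "?A (walk {0} {} origin (\<psi> k)) = x"
      by (rule cube_eqI[OF A_cube[OF \<psi>k] x_cube]) (simp add: coord_map_nth[OF \<psi>k] k(2) inverse \<rho>_0)
    then show ?thesis using x_cube k \<psi>(3) by (simp add: compose_eq)
  qed
  ultimately show ?thesis using A by (auto simp: aut_orbit_def)
qed

end

theorem theorem4:
  fixes n d :: nat and T :: "nat list \<Rightarrow> nat list"
  assumes "n \<ge> 3" and "d \<ge> 2" and "T \<in> line_perms n d"
  shows "\<exists>A \<in> aut_group n d.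
           (\<forall>p \<in> corners n d. compose (cube n d) A T p = p) \<and>
           (\<forall>p \<in> first_axis n d. compose (cube n d) A T p = p)"
proof -
  interpret cube_lines n d using assms(1,2) by unfold_locales
  obtain T\<^sub>1 where T\<^sub>1: "T\<^sub>1 \<in> aut_orbit T" "\<forall>p\<in>corners n d. T\<^sub>1 p = p"
    using ex_aut_orbit_fixes_corners[OF assms(3)] by blast
  then obtain T\<^sub>2 where T\<^sub>2: "T\<^sub>2 \<in> aut_orbit T\<^sub>1"
    "\<forall>p\<in>corners n d. T\<^sub>2 p = p" "\<forall>p\<in>first_axis n d. T\<^sub>2 p = p"
    using ex_aut_orbit_fixes_first_axis aut_orbit_line_perm[OF assms(3)] by blast
  obtain A where "A \<in> aut_group n d" "T\<^sub>2 = compose (cube n d) A T"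
    using aut_orbit_trans[OF assms(3) T\<^sub>1(1) T\<^sub>2(1)] by (auto simp: aut_orbit_def)
  then show ?thesis using T\<^sub>2(2,3) by blast
qed

end
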